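(* Let $G$ be an essentially principal étale groupoid whose unit space is a Cantor set. Suppose that $G$ is purely infinite and minimal. Then any non-trivial subgroup of $[[G]]$ normalized by the commutator subgroup $D([[G]])$ contains $D([[G]])$. In particular, $D([[G]])$ is simple.
   Context: A Cantor set is a (non-empty) compact, metrizable, totally disconnected space with no isolated points. Clopen means closed and open. An étale groupoid is a second countable locally compact Hausdorff topological groupoid $G$ whose range map is a local homeomorphism. $G^{(0)}$ is the unit space, $s,r$ are the source and range maps, and $gh$ is defined when $s(g)=r(h)$. The $G$-orbit of $x\in G^{(0)}$ is $\{r(g)\mid g\in G,\ s(g)=x\}$; $G$ is minimal if every $G$-orbit is dense in $G^{(0)}$. $G$ is essentially principal if the interior of $\{g\in G\mid r(g)=s(g)\}$ is $G^{(0)}$. A $G$-set is a subset $U\subset G$ such that $r|U$ and $s|U$ are injective; for an open $G$-set $U$, $\pi_U=r\circ(s|U)^{-1}:s(U)\to r(U)$ (a homeomorphism). When $G^{(0)}$ is compact, the topological full group $[[G]]$ is the group of all $\alpha\in\mathrm{Homeo}(G^{(0)})$ for which there is a compact open $G$-set $U$ with $\alpha=\pi_U$ (so $s(U)=r(U)=G^{(0)}$). $D(\Gamma)$ denotes the commutator subgroup of a group $\Gamma$. A clopen set $A\subset G^{(0)}$ is properly infinite if there exist compact open $G$-sets $U,V\subset G$ such that $s(U)=s(V)=A$, $r(U)\cup r(V)\subset A$ and $r(U)\cap r(V)=\emptyset$. $G$ is purely infinite if every clopen set $A\subset G^{(0)}$ is properly infinite. *)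

theory Defs
  imports "HOL-Analysis.Analysis" "HOL-Algebra.Generated_Groups" "HOL-Algebra.Bij"
begin

definition totally_disconnected_space :: "'a topology \<Rightarrow> bool" where
  "totally_disconnected_space X \<longleftrightarrow>
     (\<forall>C. connectedin X C \<longrightarrow> (\<forall>x\<in>C. \<forall>y\<in>C. x = y))"

definition cantor_space :: "'a topology \<Rightarrow> bool" where
  "cantor_space X \<longleftrightarrow>
     topspace X \<noteq> {} \<and> compact_space X \<and> metrizable_space X \<and>
     totally_disconnected_space X \<and> (\<forall>x\<in>topspace X. \<not> openin X {x})"

definition local_homeomorphism :: "'a topology \<Rightarrow> 'b topology \<Rightarrow> ('a \<Rightarrow> 'b) \<Rightarrow> bool" where
  "local_homeomorphism X Y f \<longleftrightarrow>
     (\<forall>x\<in>topspace X. \<exists>U. openin X U \<and> x \<in> U \<and> openin Y (f ` U) \<and>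
        homeomorphic_map (subtopology X U) (subtopology Y (f ` U)) f)"

definition clopenin :: "'a topology \<Rightarrow> 'a set \<Rightarrow> bool" where
  "clopenin X A \<longleftrightarrow> closedin X A \<and> openin X A"

text \<open>
  The set of arrows is the underlying set of the topology; units are identified with identity
  arrows, so source and range are maps from arrows to arrows.  The product is a total function
  whose value is constrained only on composable pairs.
\<close>

record 'g groupoid =
  arrow_topology :: "'g topology"
  rng :: "'g \<Rightarrow> 'g"
  src :: "'g \<Rightarrow> 'g"
  gmult :: "'g \<Rightarrow> 'g \<Rightarrow> 'g"
  ginv :: "'g \<Rightarrow> 'g"

abbreviation arrows :: "'g groupoid \<Rightarrow> 'g set" where
  "arrows G \<equiv> topspace (arrow_topology G)"

definition units :: "'g groupoid \<Rightarrow> 'g set" where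
  "units G = rng G ` arrows G"

abbreviation unit_space :: "'g groupoid \<Rightarrow> 'g topology" where
  "unit_space G \<equiv> subtopology (arrow_topology G) (units G)"

definition composable :: "'g groupoid \<Rightarrow> ('g \<times> 'g) set" where
  "composable G = {(g, h). g \<in> arrows G \<and> h \<in> arrows G \<and> src G g = rng G h}"

locale topological_groupoid =
  fixes G :: "'g groupoid"
  assumes rng_closed: "g \<in> arrows G \<Longrightarrow> rng G g \<in> arrows G"
    and src_closed: "g \<in> arrows G \<Longrightarrow> src G g \<in> arrows G"
    and rng_rng: "g \<in> arrows G \<Longrightarrow> rng G (rng G g) = rng G g"
    and src_rng: "g \<in> arrows G \<Longrightarrow> src G (rng G g) = rng G g"
    and rng_src: "g \<in> arrows G \<Longrightarrow> rng G (src G g) = src G g"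
    and src_src: "g \<in> arrows G \<Longrightarrow> src G (src G g) = src G g"
    and gmult_closed: "(g, h) \<in> composable G \<Longrightarrow> gmult G g h \<in> arrows G"
    and rng_gmult: "(g, h) \<in> composable G \<Longrightarrow> rng G (gmult G g h) = rng G g"
    and src_gmult: "(g, h) \<in> composable G \<Longrightarrow> src G (gmult G g h) = src G h"
    and gmult_assoc: "\<lbrakk>(g, h) \<in> composable G; (h, k) \<in> composable G\<rbrakk>
          \<Longrightarrow> gmult G (gmult G g h) k = gmult G g (gmult G h k)"
    and rng_gmult_left: "g \<in> arrows G \<Longrightarrow> gmult G (rng G g) g = g"
    and src_gmult_right: "g \<in> arrows G \<Longrightarrow> gmult G g (src G g) = g"
    and ginv_closed: "g \<in> arrows G \<Longrightarrow> ginv G g \<in> arrows G"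
    and rng_ginv: "g \<in> arrows G \<Longrightarrow> rng G (ginv G g) = src G g"
    and src_ginv: "g \<in> arrows G \<Longrightarrow> src G (ginv G g) = rng G g"
    and gmult_ginv_right: "g \<in> arrows G \<Longrightarrow> gmult G g (ginv G g) = rng G g"
    and gmult_ginv_left: "g \<in> arrows G \<Longrightarrow> gmult G (ginv G g) g = src G g"
    and continuous_gmult:
      "continuous_map
         (subtopology (prod_topology (arrow_topology G) (arrow_topology G)) (composable G))
         (arrow_topology G) (\<lambda>(g, h). gmult G g h)"
    and continuous_ginv: "continuous_map (arrow_topology G) (arrow_topology G) (ginv G)"

locale etale_groupoid = topological_groupoid +
  assumes second_countable: "second_countable (arrow_topology G)"
    and locally_compact: "locally_compact_space (arrow_topology G)"
    and Hausdorff: "Hausdorff_space (arrow_topology G)"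
    and local_homeomorphism_rng: "local_homeomorphism (arrow_topology G) (unit_space G) (rng G)"

definition orbit_of :: "'g groupoid \<Rightarrow> 'g \<Rightarrow> 'g set" where
  "orbit_of G x = {rng G g | g. g \<in> arrows G \<and> src G g = x}"

definition minimal_groupoid :: "'g groupoid \<Rightarrow> bool" where
  "minimal_groupoid G \<longleftrightarrow> (\<forall>x\<in>units G. unit_space G closure_of orbit_of G x = units G)"

definition essentially_principal :: "'g groupoid \<Rightarrow> bool" where
  "essentially_principal G \<longleftrightarrow>
     arrow_topology G interior_of {g \<in> arrows G. rng G g = src G g} = units G"

definition G_set :: "'g groupoid \<Rightarrow> 'g set \<Rightarrow> bool" where
  "G_set G U \<longleftrightarrow> U \<subseteq> arrows G \<and> inj_on (rng G) U \<and> inj_on (src G) U"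

definition compact_open_G_set :: "'g groupoid \<Rightarrow> 'g set \<Rightarrow> bool" where
  "compact_open_G_set G U \<longleftrightarrow>
     G_set G U \<and> compactin (arrow_topology G) U \<and> openin (arrow_topology G) U"

definition properly_infinite :: "'g groupoid \<Rightarrow> 'g set \<Rightarrow> bool" where
  "properly_infinite G A \<longleftrightarrow>
     (\<exists>U V. compact_open_G_set G U \<and> compact_open_G_set G V \<and>
        src G ` U = A \<and> src G ` V = A \<and>
        rng G ` U \<union> rng G ` V \<subseteq> A \<and> rng G ` U \<inter> rng G ` V = {})"

definition purely_infinite :: "'g groupoid \<Rightarrow> bool" where
  "purely_infinite G \<longleftrightarrow> (\<forall>A. clopenin (unit_space G) A \<longrightarrow> properly_infinite G A)"

definition G_set_map :: "'g groupoid \<Rightarrow> 'g set \<Rightarrow> 'g \<Rightarrow> 'g" where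
  "G_set_map G U = restrict (rng G \<circ> the_inv_into U (src G)) (src G ` U)"

text \<open>
  Self-homeomorphisms of the unit space are represented by functions that are extensional
  (\<^const>\<open>undefined\<close> outside the unit space), as in \<^const>\<open>BijGroup\<close>, whose product
  is composition.  The conditions on the source and range of \<open>U\<close> are stated explicitly because
  equality of extensional functions does not by itself determine their domains.
\<close>

definition topological_full_group :: "'g groupoid \<Rightarrow> ('g \<Rightarrow> 'g) monoid" where
  "topological_full_group G = (BijGroup (units G))
     \<lparr>carrier := {\<alpha> \<in> extensional (units G).
        homeomorphic_map (unit_space G) (unit_space G) \<alpha> \<and>
        (\<exists>U. compact_open_G_set G U \<and> src G ` U = units G \<and> rng G ` U = units G \<and>
             \<alpha> = G_set_map G U)}\<rparr>"

abbreviation commutator_subgroup :: "('a, 'b) monoid_scheme \<Rightarrow> 'a set" where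
  "commutator_subgroup \<Gamma> \<equiv> derived \<Gamma> (carrier \<Gamma>)"

definition normalized_by :: "('a, 'b) monoid_scheme \<Rightarrow> 'a set \<Rightarrow> 'a set \<Rightarrow> bool" where
  "normalized_by \<Gamma> H K \<longleftrightarrow>
     (\<forall>k\<in>K. (\<lambda>h. k \<otimes>\<^bsub>\<Gamma>\<^esub> h \<otimes>\<^bsub>\<Gamma>\<^esub> inv\<^bsub>\<Gamma>\<^esub> k) ` H = H)"

text \<open>
  The locale \<open>simple_group\<close> of \<open>HOL-Algebra\<close> requires \<open>order G > 1\<close>, which excludes infinite
  groups because \<^const>\<open>order\<close> is 0 for them.
\<close>

definition simple_as_group :: "('a, 'b) monoid_scheme \<Rightarrow> bool" where
  "simple_as_group \<Gamma> \<longleftrightarrow>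
     group \<Gamma> \<and> carrier \<Gamma> \<noteq> {\<one>\<^bsub>\<Gamma>\<^esub>} \<and>
     (\<forall>N. N \<lhd> \<Gamma> \<longrightarrow> N = {\<one>\<^bsub>\<Gamma>\<^esub>} \<or> N = carrier \<Gamma>)"

end

theory Submission
  imports Defs
begin

text \<open>
  Minimality and pure infiniteness make any clopen set \<open>A\<close> equivalent, through a compact open
  \<open>G\<close>-set, to a subset of any nonempty clopen set \<open>B\<close>. When \<open>A\<close> and \<open>B\<close> are disjoint this
  \<open>G\<close>-set and its inverse give an element of the full group exchanging \<open>A\<close> with a part of \<open>B\<close> and
  fixing everything else. From here on only such swaps matter. Let \<open>H \<noteq> 1\<close> be normalized by
  \<open>D = D([[G]])\<close> and let \<open>h \<in> H\<close> move \<open>B\<close> off itself. If \<open>a\<close>, \<open>b \<in> D\<close> are supported in \<open>B\<close>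
  then \<open>[a,b] = [[a,h],b] \<in> H\<close>. An element \<open>a\<close> supported in a small part \<open>A\<close> of \<open>B\<close> agrees on
  \<open>A\<close> with some \<open>[a,s] \<in> D\<close>, where \<open>s\<close> swaps \<open>A\<close> into another part of \<open>B\<close>; using two different
  such parts for \<open>a\<close> and \<open>b\<close> one gets \<open>[a,b] \<in> H\<close> for all \<open>a\<close>, \<open>b\<close> supported in \<open>A\<close>. Every proper
  clopen set can be moved into \<open>A\<close> by elements of \<open>D\<close>, so \<open>[a,b] \<in> H\<close> whenever \<open>a\<close>, \<open>b\<close> have
  support in a common proper clopen set. Modulo the normal core \<open>N\<close> of \<open>H\<close>, an element with proper
  support may therefore be conjugated so that its support becomes compatible with that of any other
  one; hence such elements commute modulo \<open>N\<close>, and as they generate the group, \<open>D \<subseteq> N \<subseteq> H\<close>.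
\<close>

section \<open>Groups of bijections with swaps\<close>

context group
begin

abbreviation comm :: "'a \<Rightarrow> 'a \<Rightarrow> 'a" where
  "comm a b \<equiv> a \<otimes> b \<otimes> inv a \<otimes> inv b"

lemma inv_mult_cancel_left:
  "x \<in> carrier G \<Longrightarrow> y \<in> carrier G \<Longrightarrow> inv x \<otimes> (x \<otimes> y) = y"
  "x \<in> carrier G \<Longrightarrow> y \<in> carrier G \<Longrightarrow> x \<otimes> (inv x \<otimes> y) = y"
  by (simp_all flip: m_assoc)

lemmas cancel_simps = m_assoc inv_mult_group inv_mult_cancel_left

text \<open>Moving \<open>b\<close> past \<open>x\<close> places it next to \<open>inv b\<close>,
  where it cancels. In later use \<open>b\<close> is an auxiliary factor whose support misses that
  of \<open>x\<close>.\<close>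

lemma comm_mult_left_commuting:
  assumes "a \<in> carrier G" "b \<in> carrier G" "x \<in> carrier G" "b \<otimes> x = x \<otimes> b"
  shows "comm (a \<otimes> b) x = comm a x"
proof -
  have "comm (a \<otimes> b) x = a \<otimes> (b \<otimes> x) \<otimes> inv b \<otimes> inv a \<otimes> inv x"
    using assms(1-3) by (simp add: cancel_simps)
  also have "\<dots> = comm a x"
    using assms(1-3) unfolding assms(4) by (simp add: cancel_simps)
  finally show ?thesis .
qed

lemma comm_mult_right_commuting:
  assumes "a \<in> carrier G" "b \<in> carrier G" "x \<in> carrier G" "b \<otimes> a = a \<otimes> b"
  shows "comm a (x \<otimes> b) = comm a x"
proof -
  have "inv b \<otimes> inv a = inv a \<otimes> inv b"
    using assms by (metis inv_mult_group)
  then have "b \<otimes> (inv a \<otimes> (inv b \<otimes> inv x)) = b \<otimes> (inv b \<otimes> inv a) \<otimes> inv x"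
    using assms(1-3) by (simp add: m_assoc)
  also have "\<dots> = inv a \<otimes> inv x"
    using assms(1-3) by (simp add: cancel_simps)
  finally show ?thesis
    using assms(1-3) by (simp add: cancel_simps)
qed

text \<open>With \<open>comm_mult_right\<close>, this lets membership of a commutator in a normal
  subgroup be checked on the factors of either entry.\<close>

lemma comm_mult_left:
  assumes "a \<in> carrier G" "b \<in> carrier G" "x \<in> carrier G"
  shows "comm (a \<otimes> b) x = a \<otimes> comm b x \<otimes> inv a \<otimes> comm a x"
  using assms by (simp add: cancel_simps)

lemma comm_mult_right:
  assumes "a \<in> carrier G" "b \<in> carrier G" "x \<in> carrier G"
  shows "comm x (a \<otimes> b) = comm x a \<otimes> (a \<otimes> comm x b \<otimes> inv a)"
  using assms by (simp add: cancel_simps)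

lemma conj_comm:
  assumes "a \<in> carrier G" "b \<in> carrier G" "x \<in> carrier G"
  shows "x \<otimes> comm a b \<otimes> inv x = comm (x \<otimes> a \<otimes> inv x) (x \<otimes> b \<otimes> inv x)"
  using assms by (simp add: cancel_simps)

lemma comm_in_derived: "a \<in> carrier G \<Longrightarrow> b \<in> carrier G \<Longrightarrow> comm a b \<in> derived G (carrier G)"
  unfolding derived_def by (rule generate.incl) blast

text \<open>The set is the intersection of all conjugates of \<open>H\<close>. Conjugating by
  \<open>x\<close> only replaces the test element \<open>g\<close> by \<open>g \<otimes> x\<close>,
  hence normality.\<close>

lemma conj_core_normal:
  assumes H: "subgroup H G"
  shows "{h \<in> carrier G. \<forall>g\<in>carrier G. g \<otimes> h \<otimes> inv g \<in> H} \<lhd> G" (is "?N \<lhd> G")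
proof (rule normal_invI)
  show "subgroup ?N G"
  proof (rule subgroupI)
    show "?N \<subseteq> carrier G" by blast
    show "?N \<noteq> {}" using subgroup.one_closed[OF H] by (auto intro!: exI[of _ \<one>])
  next
    fix a assume a: "a \<in> ?N"
    have "g \<otimes> inv a \<otimes> inv g \<in> H" if g: "g \<in> carrier G" for g
    proof -
      have "inv (g \<otimes> a \<otimes> inv g) \<in> H"
        using a g subgroup.m_inv_closed[OF H] by blast
      then show ?thesis using a g by (simp add: cancel_simps)
    qed
    with a show "inv a \<in> ?N" by auto
  next
    fix a b assume a: "a \<in> ?N" and b: "b \<in> ?N"
    have "g \<otimes> (a \<otimes> b) \<otimes> inv g \<in> H" if g: "g \<in> carrier G" for g
    proof -
      have "(g \<otimes> a \<otimes> inv g) \<otimes> (g \<otimes> b \<otimes> inv g) \<in> H"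
        using a b g subgroup.m_closed[OF H] by blast
      then show ?thesis using a b g by (simp add: cancel_simps)
    qed
    with a b show "a \<otimes> b \<in> ?N" by auto
  qed
next
  fix x h assume x: "x \<in> carrier G" and h: "h \<in> ?N"
  have "g \<otimes> (x \<otimes> h \<otimes> inv x) \<otimes> inv g \<in> H" if g: "g \<in> carrier G" for g
  proof -
    have "(g \<otimes> x) \<otimes> h \<otimes> inv (g \<otimes> x) \<in> H" using h g x by blast
    then show ?thesis using x h g by (simp add: cancel_simps)
  qed
  with x h show "x \<otimes> h \<otimes> inv x \<in> ?N" by auto
qed

end

text \<open>Interface between groupoid and group theory. \<open>\<A>\<close> stands for the clopen
  sets: \<open>split\<close> reflects the absence of isolated points, \<open>displace\<close> the
  Hausdorff property and zero-dimensionality, \<open>swap_into\<close> minimality and pure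
  infiniteness, and \<open>swap_along\<close> the restriction of a compact open G-set to smaller
  sources.\<close>

locale swapping_group = group \<Gamma> + algebra X \<A>
  for \<Gamma> :: "('a \<Rightarrow> 'a) monoid" (structure) and X :: "'a set" and \<A> :: "'a set set" +
  assumes carrier_Bij: "carrier \<Gamma> \<subseteq> Bij X"
    and mult_apply: "f \<in> carrier \<Gamma> \<Longrightarrow> g \<in> carrier \<Gamma> \<Longrightarrow> x \<in> X \<Longrightarrow> (f \<otimes> g) x = f (g x)"
    and X_nonempty: "X \<noteq> {}"
    and image_closed: "f \<in> carrier \<Gamma> \<Longrightarrow> A \<in> \<A> \<Longrightarrow> f ` A \<in> \<A>"
    and split: "A \<in> \<A> \<Longrightarrow> A \<noteq> {} \<Longrightarrow> \<exists>B\<in>\<A>. B \<subset> A \<and> B \<noteq> {}"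
    and displace: "f \<in> carrier \<Gamma> \<Longrightarrow> x \<in> X \<Longrightarrow> f x \<noteq> x \<Longrightarrow> \<exists>A\<in>\<A>. x \<in> A \<and> f ` A \<inter> A = {}"
    and swap_into: "A \<in> \<A> \<Longrightarrow> B \<in> \<A> \<Longrightarrow> B \<noteq> {} \<Longrightarrow> A \<inter> B = {} \<Longrightarrow>
          \<exists>s\<in>carrier \<Gamma>. s ` A \<subseteq> B \<and> (\<forall>x\<in>X - (A \<union> B). s x = x)"
    and swap_along: "f \<in> carrier \<Gamma> \<Longrightarrow> A \<in> \<A> \<Longrightarrow> f ` A \<inter> A = {} \<Longrightarrow>
          \<exists>s\<in>carrier \<Gamma>. (\<forall>x\<in>A. s x = f x) \<and> (\<forall>x\<in>X - (A \<union> f ` A). s x = x)"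
begin

text \<open>The rigid stabilizer of \<open>A\<close>: the elements supported in
  \<open>A\<close>.\<close>

definition rist :: "'a set \<Rightarrow> ('a \<Rightarrow> 'a) set" where
  "rist A = {f \<in> carrier \<Gamma>. \<forall>x\<in>X - A. f x = x}"

section \<open>Pointwise action and supports\<close>

lemma carrier_bij_betw: "f \<in> carrier \<Gamma> \<Longrightarrow> bij_betw f X X"
  using carrier_Bij by (auto simp: Bij_def)

lemma carrier_ext: "f \<in> carrier \<Gamma> \<Longrightarrow> f \<in> extensional X"
  using carrier_Bij by (auto simp: Bij_def)

lemma apply_closed: "f \<in> carrier \<Gamma> \<Longrightarrow> x \<in> X \<Longrightarrow> f x \<in> X"
  using carrier_bij_betw bij_betwE by blast

lemma apply_eq_iff: "f \<in> carrier \<Gamma> \<Longrightarrow> x \<in> X \<Longrightarrow> y \<in> X \<Longrightarrow> f x = f y \<longleftrightarrow> x = y"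
  using carrier_bij_betw by (auto simp: bij_betw_def inj_on_def)

lemma carrier_eqI:
  "f \<in> carrier \<Gamma> \<Longrightarrow> g \<in> carrier \<Gamma> \<Longrightarrow> (\<And>x. x \<in> X \<Longrightarrow> f x = g x) \<Longrightarrow> f = g"
  by (meson carrier_ext extensionalityI)

text \<open>Since \<open>\<one>\<close> is idempotent, \<open>\<one> (\<one> x) = \<one> x\<close>,
  and injectivity cancels one application.\<close>

lemma one_apply: "x \<in> X \<Longrightarrow> \<one> x = x"
  by (metis apply_closed apply_eq_iff l_one mult_apply one_closed)

lemma inv_apply [simp]:
  assumes "f \<in> carrier \<Gamma>" "x \<in> X"
  shows "(inv f) (f x) = x" "f ((inv f) x) = x"
  using assms by (metis inv_closed l_inv mult_apply one_apply, metis inv_closed r_inv mult_apply one_apply)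

lemma in_X: "A \<in> \<A> \<Longrightarrow> x \<in> A \<Longrightarrow> x \<in> X"
  using space_closed by blast

lemma rist_carrier: "f \<in> rist A \<Longrightarrow> f \<in> carrier \<Gamma>"
  by (simp add: rist_def)

lemma rist_mono: "A \<subseteq> B \<Longrightarrow> rist A \<subseteq> rist B"
  by (auto simp: rist_def)

lemma rist_mult: "f \<in> rist A \<Longrightarrow> g \<in> rist A \<Longrightarrow> f \<otimes> g \<in> rist A"
  by (auto simp: rist_def mult_apply)

lemma rist_inv: "f \<in> rist A \<Longrightarrow> inv f \<in> rist A"
  unfolding rist_def using inv_apply(1)[of f] by fastforce

lemma rist_comm: "f \<in> rist A \<Longrightarrow> g \<in> rist A \<Longrightarrow> comm f g \<in> rist A"
  by (simp add: rist_mult rist_inv)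

text \<open>If \<open>f x\<close> were outside \<open>A\<close>, then \<open>f\<close> would fix it,
  and injectivity would give \<open>f x = x\<close>.\<close>

lemma rist_maps:
  assumes f: "f \<in> rist A" and x: "x \<in> X" "x \<in> A"
  shows "f x \<in> A"
proof (rule ccontr)
  assume "f x \<notin> A"
  moreover have fx: "f x \<in> X" using apply_closed rist_carrier[OF f] x(1) by blast
  ultimately have "f (f x) = f x" using f by (simp add: rist_def)
  then have "f x = x" using apply_eq_iff[OF rist_carrier[OF f] fx x(1)] by blast
  then show False using \<open>f x \<notin> A\<close> x(2) by simp
qed

lemma rist_commute:
  assumes f: "f \<in> rist A" and g: "g \<in> rist B" and "A \<inter> B = {}"
  shows "f \<otimes> g = g \<otimes> f"
proof (rule carrier_eqI)
  show "f \<otimes> g \<in> carrier \<Gamma>" "g \<otimes> f \<in> carrier \<Gamma>"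
    using f g rist_carrier by auto
  fix x assume x: "x \<in> X"
  note c = rist_carrier[OF f] rist_carrier[OF g]
  have F: "f y = y" if "y \<in> X" "y \<notin> A" for y using f that by (simp add: rist_def)
  have G: "g y = y" if "y \<in> X" "y \<notin> B" for y using g that by (simp add: rist_def)
  note cl = apply_closed[OF c(1) x] apply_closed[OF c(2) x]
  have "f (g x) = g (f x)"
  proof (cases "x \<in> A")
    case True
    then have "f x \<notin> B" "x \<notin> B" using rist_maps[OF f x] assms(3) by auto
    then show ?thesis using G x cl by simp
  next
    case False
    then have "g x \<notin> A" using rist_maps[OF g x] G[OF x] assms(3) by (cases "x \<in> B") auto
    then show ?thesis using F x cl False by simp
  qed
  then show "(f \<otimes> g) x = (g \<otimes> f) x" using c x by (simp add: mult_apply)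
qed

text \<open>The support of a conjugate is the image of the support. \<open>A\<close> may be any set
  here, so only its points in \<open>X\<close> are tested.\<close>

lemma rist_conj:
  assumes f: "f \<in> carrier \<Gamma>" and g: "g \<in> rist A" and sub: "f ` (A \<inter> X) \<subseteq> B"
  shows "f \<otimes> g \<otimes> inv f \<in> rist B"
proof -
  note c = f rist_carrier[OF g]
  have "(f \<otimes> g \<otimes> inv f) x = x" if x: "x \<in> X - B" for x
  proof -
    have y: "(inv f) x \<in> X" using x c apply_closed by auto
    have "(inv f) x \<notin> A"
    proof
      assume "(inv f) x \<in> A"
      then have "f ((inv f) x) \<in> B" using y sub by blast
      then show False using x c by simp
    qed
    then have "g ((inv f) x) = (inv f) x" using g y by (simp add: rist_def)
    then show ?thesis using x c y by (simp add: mult_apply)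
  qed
  then show ?thesis using c by (simp add: rist_def)
qed

section \<open>Moving clopen sets by commutators\<close>

lemma three_disjoint_subsets:
  assumes "A \<in> \<A>" "A \<noteq> {}"
  obtains A1 A2 A3 where "A1 \<in> \<A>" "A2 \<in> \<A>" "A3 \<in> \<A>" "A1 \<noteq> {}" "A2 \<noteq> {}" "A3 \<noteq> {}"
    "A1 \<subseteq> A" "A2 \<subseteq> A" "A3 \<subseteq> A" "A1 \<inter> A2 = {}" "A1 \<inter> A3 = {}" "A2 \<inter> A3 = {}"
proof -
  obtain B where B: "B \<in> \<A>" "B \<subset> A" "B \<noteq> {}" using split assms by blast
  obtain C where C: "C \<in> \<A>" "C \<subset> B" "C \<noteq> {}" using split B by blast
  show ?thesis
    by (rule that[of "A - B" "B - C" C]) (use assms B C in auto)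
qed

text \<open>A swap \<open>s\<close> need not lie in the commutator subgroup, but
  \<open>comm s r\<close> does, and it agrees with \<open>s\<close> on \<open>C\<close> if
  \<open>r\<close> carries the support of \<open>s\<close> away from it. The hypothesis
  \<open>ne\<close> provides the room \<open>F\<close> for this.\<close>

lemma derived_swap_into:
  assumes C: "C \<in> \<A>" and E: "E \<in> \<A>" "E \<noteq> {}" and disj: "C \<inter> E = {}" and ne: "C \<union> E \<noteq> X"
  shows "\<exists>d\<in>derived \<Gamma> (carrier \<Gamma>). d ` C \<subseteq> E"
proof -
  obtain s where s: "s \<in> carrier \<Gamma>" "s ` C \<subseteq> E" "\<forall>x\<in>X - (C \<union> E). s x = x"
    using swap_into[OF C E disj] by blast
  define F where "F = X - (C \<union> E)"
  have F: "F \<in> \<A>" "F \<noteq> {}" unfolding F_def using C E ne in_X by auto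
  obtain r where r: "r \<in> carrier \<Gamma>" "r ` (C \<union> E) \<subseteq> F"
    using swap_into[of "C \<union> E" F] C E F by (auto simp: F_def)
  have si: "s \<in> rist (C \<union> E)" using s by (simp add: rist_def)
  define t where "t = r \<otimes> inv s \<otimes> inv r"
  have t: "t \<in> rist F"
    unfolding t_def by (rule rist_conj[OF r(1) rist_inv[OF si]]) (use r in auto)
  have eq: "comm s r = s \<otimes> t"
    using s(1) r(1) unfolding t_def by (simp add: m_assoc)
  have "comm s r x = s x" if "x \<in> C" for x
  proof -
    have "x \<in> X - F" using that C in_X by (auto simp: F_def)
    then have "t x = x" using t by (simp add: rist_def)
    then show ?thesis
      using eq mult_apply[OF s(1) rist_carrier[OF t]] that C in_X by simp
  qed
  then have "comm s r ` C \<subseteq> E" using s(2) by auto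
  with comm_in_derived[OF s(1) r(1)] show ?thesis by blast
qed

text \<open>An element of the commutator subgroup carrying \<open>A1\<close> into the disjoint set
  \<open>A2\<close> moves points; \<open>A3\<close> ensures that \<open>A1 \<union> A2\<close> is
  not all of \<open>X\<close>.\<close>

lemma derived_nontrivial: "derived \<Gamma> (carrier \<Gamma>) \<noteq> {\<one>}"
proof -
  obtain A1 A2 A3 where A: "A1 \<in> \<A>" "A2 \<in> \<A>" "A3 \<in> \<A>" "A1 \<noteq> {}" "A2 \<noteq> {}" "A3 \<noteq> {}"
      "A3 \<subseteq> X" "A1 \<inter> A2 = {}" "A1 \<inter> A3 = {}" "A2 \<inter> A3 = {}"
    using three_disjoint_subsets[OF top X_nonempty] by metis
  then obtain d where d: "d \<in> derived \<Gamma> (carrier \<Gamma>)" "d ` A1 \<subseteq> A2"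
    using derived_swap_into[of A1 A2] by blast
  obtain x where "x \<in> A1" using A(4) by blast
  then have "x \<in> X" "d x \<noteq> x"
    using in_X[OF A(1)] d(2) A(8) by (simp, metis disjoint_iff image_subset_iff)
  then show ?thesis using d(1) one_apply by auto
qed

text \<open>An element displacing \<open>A\<close> is cut off along \<open>A\<close> by a swap.\<close>

lemma product_of_proper_supports:
  assumes g: "g \<in> carrier \<Gamma>"
  obtains s t C D where "g = s \<otimes> t" "s \<in> rist C" "t \<in> rist D" "C \<in> \<A>" "D \<in> \<A>" "C \<noteq> X" "D \<noteq> X"
proof (cases "g = \<one>")
  case True
  then show ?thesis
    using X_nonempty one_apply by (intro that[of \<one> \<one> "{}" "{}"]) (auto simp: rist_def)
next
  case False
  then obtain x where x: "x \<in> X" "g x \<noteq> x"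
    using carrier_eqI[OF g one_closed] one_apply by auto
  then obtain B where B: "B \<in> \<A>" "x \<in> B" "g ` B \<inter> B = {}"
    using displace[OF g] by blast
  then obtain A where A: "A \<in> \<A>" "A \<subset> B" "A \<noteq> {}" using split by blast
  then have "g ` A \<inter> A = {}" using B by auto
  then obtain s where s: "s \<in> carrier \<Gamma>" "\<forall>x\<in>A. s x = g x" "\<forall>x\<in>X - (A \<union> g ` A). s x = x"
    using swap_along[OF g A(1)] by blast
  have "(inv s \<otimes> g) x = x" if "x \<in> X - (X - A)" for x
  proof -
    have "x \<in> A" "x \<in> X" using that by auto
    then have "(inv s) (g x) = (inv s) (s x)" using s(2) by simp
    then show ?thesis using s(1) g \<open>x \<in> X\<close> by (simp add: mult_apply)
  qed
  then have t: "inv s \<otimes> g \<in> rist (X - A)" using s g by (simp add: rist_def)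
  show ?thesis
  proof (rule that[of s "inv s \<otimes> g" "A \<union> g ` A" "X - A"])
    show "g = s \<otimes> (inv s \<otimes> g)" using s(1) g by (simp add: cancel_simps)
    show "s \<in> rist (A \<union> g ` A)" using s by (simp add: rist_def)
    show "inv s \<otimes> g \<in> rist (X - A)" by fact
    show "A \<union> g ` A \<in> \<A>" "X - A \<in> \<A>" using A image_closed[OF g] by auto
    show "A \<union> g ` A \<noteq> X" "X - A \<noteq> X" using A B in_X by blast+
  qed
qed

section \<open>Subgroups normalized by the commutator subgroup\<close>

context
  fixes H
  assumes H: "subgroup H \<Gamma>" and H_ne: "H \<noteq> {\<one>}"
    and H_norm: "normalized_by \<Gamma> H (derived \<Gamma> (carrier \<Gamma>))"
begin

lemma H_conj:
  "d \<in> derived \<Gamma> (carrier \<Gamma>) \<Longrightarrow> h \<in> H \<Longrightarrow> d \<otimes> h \<otimes> inv d \<in> H"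
  using H_norm unfolding normalized_by_def by blast

lemma derived_carrier: "d \<in> derived \<Gamma> (carrier \<Gamma>) \<Longrightarrow> d \<in> carrier \<Gamma>"
  using derived_in_carrier[of "carrier \<Gamma>"] by blast

lemma H_comm_derived:
  assumes "h \<in> H" "d \<in> derived \<Gamma> (carrier \<Gamma>)"
  shows "comm d h \<in> H" "comm h d \<in> H"
proof -
  have c: "h \<in> carrier \<Gamma>" "d \<in> carrier \<Gamma>"
    using assms subgroup.mem_carrier[OF H] derived_carrier by auto
  show "comm d h \<in> H"
    using H_conj[OF assms(2,1)] assms(1) H by (simp add: subgroup.m_closed subgroup.m_inv_closed)
  then have "inv (comm d h) \<in> H" using H by (simp add: subgroup.m_inv_closed)
  then show "comm h d \<in> H" using c by (simp add: cancel_simps)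
qed

lemma comm_in_H_displaced:
  assumes h: "h \<in> H" and B: "B \<in> \<A>" "h ` B \<inter> B = {}"
    and a: "a \<in> derived \<Gamma> (carrier \<Gamma>)" "a \<in> rist B"
    and b: "b \<in> derived \<Gamma> (carrier \<Gamma>)" "b \<in> rist B"
  shows "comm a b \<in> H"
proof -
  have c: "h \<in> carrier \<Gamma>" "a \<in> carrier \<Gamma>" "b \<in> carrier \<Gamma>"
    using h subgroup.mem_carrier[OF H] a b rist_carrier by auto
  have t: "h \<otimes> inv a \<otimes> inv h \<in> rist (h ` B)"
    by (rule rist_conj[OF c(1) rist_inv[OF a(2)]]) auto
  have "comm a h = a \<otimes> (h \<otimes> inv a \<otimes> inv h)" using c by (simp add: m_assoc)
  then have "comm (comm a h) b = comm a b"
    using comm_mult_left_commuting[OF c(2) _ c(3) rist_commute[OF t b(2) B(2)]] rist_carrier[OF t]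
    by simp
  then show ?thesis
    using H_comm_derived(2)[OF H_comm_derived(1)[OF h a(1)] b(1)] by simp
qed

text \<open>Unlike in \<open>comm_in_H_displaced\<close>, \<open>a\<close> and \<open>b\<close>
  range over all elements supported in \<open>A\<close>, whether or not they lie in the commutator
  subgroup.\<close>

definition good :: "'a set \<Rightarrow> bool" where
  "good A \<longleftrightarrow> (\<forall>a\<in>rist A. \<forall>b\<in>rist A. comm a b \<in> H)"

text \<open>On \<open>A1\<close>, \<open>a\<close> and \<open>b\<close> agree with the commutators
  \<open>comm a s\<close> and \<open>comm b r\<close>. The corrections \<open>a'\<close> and
  \<open>b'\<close> are pushed into different sets \<open>A2\<close> and \<open>A3\<close>, so they
  do not affect the commutator.\<close>

lemma good_exists: "\<exists>A\<in>\<A>. A \<noteq> {} \<and> good A"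
proof -
  obtain h where h: "h \<in> H" "h \<noteq> \<one>" using H_ne subgroup.one_closed[OF H] by blast
  have hc: "h \<in> carrier \<Gamma>" using h subgroup.mem_carrier[OF H] by blast
  obtain x where "x \<in> X" "h x \<noteq> x"
    using carrier_eqI[OF hc one_closed] h(2) one_apply by auto
  then obtain B where B: "B \<in> \<A>" "B \<noteq> {}" "h ` B \<inter> B = {}" using displace[OF hc] by blast
  obtain A1 A2 A3 where A: "A1 \<in> \<A>" "A2 \<in> \<A>" "A3 \<in> \<A>" "A1 \<noteq> {}" "A2 \<noteq> {}" "A3 \<noteq> {}"
    "A1 \<subseteq> B" "A2 \<subseteq> B" "A3 \<subseteq> B" "A1 \<inter> A2 = {}" "A1 \<inter> A3 = {}" "A2 \<inter> A3 = {}"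
    using three_disjoint_subsets[OF B(1,2)] by metis
  obtain s where s: "s \<in> carrier \<Gamma>" "s ` A1 \<subseteq> A2" "s \<in> rist (A1 \<union> A2)"
    using swap_into[of A1 A2] A by (auto simp: rist_def)
  obtain r where r: "r \<in> carrier \<Gamma>" "r ` A1 \<subseteq> A3" "r \<in> rist (A1 \<union> A3)"
    using swap_into[of A1 A3] A by (auto simp: rist_def)
  have "good A1"
    unfolding good_def
  proof (intro ballI)
    fix a b assume a: "a \<in> rist A1" and b: "b \<in> rist A1"
    note c = rist_carrier[OF a] rist_carrier[OF b]
    define a' where "a' = s \<otimes> inv a \<otimes> inv s"
    define b' where "b' = r \<otimes> inv b \<otimes> inv r"
    have a': "a' \<in> rist A2"
      unfolding a'_def by (rule rist_conj[OF s(1) rist_inv[OF a]]) (use s in auto)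
    have b': "b' \<in> rist A3"
      unfolding b'_def by (rule rist_conj[OF r(1) rist_inv[OF b]]) (use r in auto)
    note c' = rist_carrier[OF a'] rist_carrier[OF b']
    have as: "comm a s = a \<otimes> a'" unfolding a'_def using c s(1) by (simp add: m_assoc)
    have br: "comm b r = b \<otimes> b'" unfolding b'_def using c r(1) by (simp add: m_assoc)
    have b_b': "b \<otimes> b' \<in> rist (A1 \<union> A3)"
      using b b' rist_mono[of A1 "A1 \<union> A3"] rist_mono[of A3 "A1 \<union> A3"] by (auto intro: rist_mult)
    \<comment> \<open>First \<open>a'\<close>, supported in \<open>A2\<close>, is dropped against
      \<open>A1 \<union> A3\<close>; then \<open>b'\<close>, supported in \<open>A3\<close>, is
      dropped against \<open>A1\<close>.\<close>
    have "comm (a \<otimes> a') (b \<otimes> b') = comm a (b \<otimes> b')"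
      by (rule comm_mult_left_commuting[OF _ _ _ rist_commute[OF a' b_b']]) (use c c' A in auto)
    also have "\<dots> = comm a b"
      by (rule comm_mult_right_commuting[OF _ _ _ rist_commute[OF b' a]]) (use c c' A in auto)
    finally have "comm (comm a s) (comm b r) = comm a b" by (simp only: as br)
    moreover have "comm (comm a s) (comm b r) \<in> H"
    proof (rule comm_in_H_displaced[OF h(1) B(1,3)])
      have "a \<in> rist B" "b \<in> rist B" "s \<in> rist B" "r \<in> rist B"
        using a b s(3) r(3) rist_mono[of A1 B] rist_mono[of "A1 \<union> A2" B] rist_mono[of "A1 \<union> A3" B] A
        by auto
      then show "comm a s \<in> rist B" "comm b r \<in> rist B" by (simp_all add: rist_comm)
    qed (use comm_in_derived c s r in auto)
    ultimately show "comm a b \<in> H" by simp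
  qed
  with A show ?thesis by blast
qed

text \<open>Conjugation by \<open>d\<close> carries elements supported in \<open>C\<close> to
  elements supported in \<open>A\<close>. Conjugating back stays in \<open>H\<close> because
  \<open>inv d\<close> is in the commutator subgroup.\<close>

lemma good_pullback:
  assumes "good A" "C \<in> \<A>" and d: "d \<in> derived \<Gamma> (carrier \<Gamma>)" "d ` C \<subseteq> A"
  shows "good C"
  unfolding good_def
proof (intro ballI)
  fix a b assume a: "a \<in> rist C" and b: "b \<in> rist C"
  note dc = derived_carrier[OF d(1)]
  note c = rist_carrier[OF a] rist_carrier[OF b] dc
  have "d \<otimes> a \<otimes> inv d \<in> rist A" "d \<otimes> b \<otimes> inv d \<in> rist A"
    using rist_conj[OF dc a] rist_conj[OF dc b] d(2) by blast+
  then have "comm (d \<otimes> a \<otimes> inv d) (d \<otimes> b \<otimes> inv d) \<in> H" using assms(1) by (simp add: good_def)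
  then have *: "d \<otimes> comm a b \<otimes> inv d \<in> H" using conj_comm[OF c] by simp
  have "inv d \<in> derived \<Gamma> (carrier \<Gamma>)"
    using d(1) derived_is_subgroup[OF order_refl] by (simp add: subgroup.m_inv_closed)
  then have "inv d \<otimes> (d \<otimes> comm a b \<otimes> inv d) \<otimes> inv (inv d) \<in> H" using * by (rule H_conj)
  then show "comm a b \<in> H" using c by (simp add: cancel_simps)
qed

lemma good_all:
  assumes C: "C \<in> \<A>" "C \<noteq> X"
  shows "good C"
proof -
  obtain A where A: "A \<in> \<A>" "A \<noteq> {}" "good A" using good_exists by blast
  \<comment> \<open>The target \<open>E\<close> is chosen strictly inside \<open>B - C'\<close>, so
    that \<open>C' \<union> E\<close> is proper and \<open>derived_swap_into\<close>
    applies.\<close>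
  have pull: "good C'" if B: "B \<in> \<A>" "good B" and C': "C' \<in> \<A>" and ne: "B - C' \<noteq> {}" for B C'
  proof -
    have "B - C' \<in> \<A>" using B C' by blast
    then obtain E where E: "E \<in> \<A>" "E \<subset> B - C'" "E \<noteq> {}" using split[OF _ ne] by blast
    have "C' \<union> E \<noteq> X" using E(2) in_X[OF B(1)] by blast
    moreover have "C' \<inter> E = {}" using E(2) by blast
    ultimately obtain d where d: "d \<in> derived \<Gamma> (carrier \<Gamma>)" "d ` C' \<subseteq> E"
      using derived_swap_into[OF C' E(1,3)] by blast
    have "d ` C' \<subseteq> B" using d(2) E(2) by blast
    then show ?thesis using good_pullback[OF B(2) C' d(1)] by blast
  qed
  show ?thesis
  proof (cases "A - C = {}")
    case False
    then show ?thesis using pull[OF A(1,3) C(1)] by blast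
  next
    \<comment> \<open>Here \<open>A\<close> lies inside \<open>C\<close>, so goodness is first
      transferred to a set \<open>E\<close> outside \<open>C\<close> and from there to
      \<open>C\<close>.\<close>
    case True
    have XC: "X - C \<in> \<A>" "X - C \<noteq> {}" using C sets_into_space[OF C(1)] by auto
    obtain E where E: "E \<in> \<A>" "E \<subset> X - C" "E \<noteq> {}" using split[OF XC] by blast
    have "A - E \<noteq> {}" using True A(2) E(2) by blast
    then have "good E" by (rule pull[OF A(1,3) E(1)])
    moreover have "E - C \<noteq> {}" using E by blast
    ultimately show ?thesis using pull[OF E(1) _ C(1)] by blast
  qed
qed

text \<open>The normal core \<open>N\<close> of \<open>H\<close> permits conjugation by arbitrary
  elements. Commutators are placed in \<open>N\<close> under ever weaker conditions: a common proper
  support, two proper supports, one proper support, and finally none.\<close>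

lemma derived_subset: "derived \<Gamma> (carrier \<Gamma>) \<subseteq> H"
proof -
  define N where "N = {h \<in> carrier \<Gamma>. \<forall>g\<in>carrier \<Gamma>. g \<otimes> h \<otimes> inv g \<in> H}"
  have N: "N \<lhd> \<Gamma>" unfolding N_def by (rule conj_core_normal[OF H])
  note Nsub = normal_invE(1)[OF N] and Nconj = normal_invE(2)[OF N]
  note Nmult = subgroup.m_closed[OF Nsub] and Ninv = subgroup.m_inv_closed[OF Nsub]
  have NH: "N \<subseteq> H"
  proof
    fix h assume "h \<in> N"
    then have "\<one> \<otimes> h \<otimes> inv \<one> \<in> H" "h \<in> carrier \<Gamma>" unfolding N_def by blast+
    then show "h \<in> H" by simp
  qed
  have small: "comm a b \<in> N" if "C \<in> \<A>" "C \<noteq> X" "a \<in> rist C" "b \<in> rist C" for a b C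
  proof -
    note c = that(3,4)[THEN rist_carrier]
    have "g \<otimes> comm a b \<otimes> inv g \<in> H" if g: "g \<in> carrier \<Gamma>" for g
    proof -
      have "g ` C \<noteq> X"
      proof
        assume eq: "g ` C = X"
        have "y \<in> C" if "y \<in> X" for y
          using that eq apply_closed[OF g that] apply_eq_iff[OF g that] in_X[OF \<open>C \<in> \<A>\<close>] by (metis imageE)
        then show False using \<open>C \<noteq> X\<close> in_X[OF \<open>C \<in> \<A>\<close>] by blast
      qed
      then have "good (g ` C)" using good_all image_closed g that \<open>C \<in> \<A>\<close> by blast
      moreover have "g \<otimes> a \<otimes> inv g \<in> rist (g ` C)" "g \<otimes> b \<otimes> inv g \<in> rist (g ` C)"
        using rist_conj[OF g \<open>a \<in> rist C\<close>] rist_conj[OF g \<open>b \<in> rist C\<close>] by blast+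
      ultimately have "comm (g \<otimes> a \<otimes> inv g) (g \<otimes> b \<otimes> inv g) \<in> H" by (simp add: good_def)
      then show ?thesis using conj_comm[OF c g] by simp
    qed
    then show ?thesis unfolding N_def using c by simp
  qed
  have medium: "comm a b \<in> N"
    if C: "C \<in> \<A>" "C \<noteq> X" and D: "D \<in> \<A>" "D \<noteq> X" and a: "a \<in> rist C" and b: "b \<in> rist D" for a b C D
  proof (cases "C \<union> D = X")
    case False
    have "a \<in> rist (C \<union> D)" "b \<in> rist (C \<union> D)"
      using a b rist_mono[of C "C \<union> D"] rist_mono[of D "C \<union> D"] by auto
    then show ?thesis using small[of "C \<union> D"] False C D by blast
  next
    \<comment> \<open>Now \<open>X - C\<close> lies in \<open>D\<close>. Writing
      \<open>a = comm a s \<otimes> a'\<close>, the first factor is in \<open>N\<close> because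
      \<open>C \<union> E\<close> is proper, while \<open>a'\<close> is supported in
      \<open>E\<close>, hence in \<open>D\<close>, together with \<open>b\<close>.\<close>
    case True
    have XC: "X - C \<in> \<A>" "X - C \<noteq> {}" using C sets_into_space[OF C(1)] by auto
    obtain E where E: "E \<in> \<A>" "E \<subset> X - C" "E \<noteq> {}" using split[OF XC] by blast
    obtain s where s: "s \<in> carrier \<Gamma>" "s ` C \<subseteq> E" "s \<in> rist (C \<union> E)"
      using swap_into[of C E] C E by (auto simp: rist_def)
    note c = rist_carrier[OF a] rist_carrier[OF b] s(1)
    define a' where "a' = s \<otimes> a \<otimes> inv s"
    have "a' \<in> rist E" unfolding a'_def by (rule rist_conj[OF s(1) a]) (use s in auto)
    then have a': "a' \<in> rist D" using rist_mono[of E D] E True by blast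
    have ac: "a' \<in> carrier \<Gamma>" using a' rist_carrier by blast
    have "C \<union> E \<noteq> X" using E by blast
    then have n: "comm a s \<in> N"
      using small[of "C \<union> E" a s] C E s a rist_mono[of C "C \<union> E"] by blast
    then have nc: "comm a s \<in> carrier \<Gamma>" unfolding N_def by blast
    have eq: "a = comm a s \<otimes> a'" using c by (simp add: a'_def cancel_simps)
    have "comm a' b \<in> N" using small[OF D a' b] .
    then have 1: "comm a s \<otimes> comm a' b \<otimes> inv (comm a s) \<in> N" using Nconj[OF nc] by blast
    have "comm (comm a s) b = comm a s \<otimes> (b \<otimes> inv (comm a s) \<otimes> inv b)"
      using c by (simp add: m_assoc)
    then have 2: "comm (comm a s) b \<in> N" using Nmult[OF n Nconj[OF c(2) Ninv[OF n]]] by simp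
    have "comm (comm a s \<otimes> a') b \<in> N"
      unfolding comm_mult_left[OF nc ac c(2)] by (rule Nmult[OF 1 2])
    then show ?thesis using eq by simp
  qed
  \<comment> \<open>Factoring first the left and then, in \<open>all\<close>, the right entry into
    elements of proper support reduces the general case to \<open>medium\<close>.\<close>
  have left: "comm a b \<in> N" if a: "a \<in> carrier \<Gamma>" and D: "D \<in> \<A>" "D \<noteq> X" "b \<in> rist D" for a b D
  proof -
    obtain s t C C' where st: "a = s \<otimes> t" "s \<in> rist C" "t \<in> rist C'" "C \<in> \<A>" "C' \<in> \<A>" "C \<noteq> X" "C' \<noteq> X"
      using product_of_proper_supports[OF a] by metis
    note c = st(2,3)[THEN rist_carrier] rist_carrier[OF D(3)]
    show ?thesis
      unfolding st(1) comm_mult_left[OF c]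
      using Nmult[OF Nconj[OF c(1) medium[OF st(5,7) D(1,2) st(3) D(3)]] medium[OF st(4,6) D(1,2) st(2) D(3)]] .
  qed
  have all: "comm a b \<in> N" if a: "a \<in> carrier \<Gamma>" and b: "b \<in> carrier \<Gamma>" for a b
  proof -
    obtain s t C C' where st: "b = s \<otimes> t" "s \<in> rist C" "t \<in> rist C'" "C \<in> \<A>" "C' \<in> \<A>" "C \<noteq> X" "C' \<noteq> X"
      using product_of_proper_supports[OF b] by metis
    note c = st(2,3)[THEN rist_carrier] a
    show ?thesis
      unfolding st(1) comm_mult_right[OF c]
      using Nmult[OF left[OF a st(4,6,2)] Nconj[OF c(1) left[OF a st(5,7,3)]]] .
  qed
  have "derived \<Gamma> (carrier \<Gamma>) \<subseteq> N"
    unfolding derived_def by (rule generate_subgroup_incl[OF _ Nsub]) (use all in blast)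
  then show ?thesis using NH by blast
qed

end

text \<open>A normal subgroup of the commutator subgroup is a subgroup of \<open>\<Gamma>\<close>
  normalized by it, so \<open>derived_subset\<close> applies once it is nontrivial.\<close>

lemma derived_simple: "simple_as_group (\<Gamma>\<lparr>carrier := derived \<Gamma> (carrier \<Gamma>)\<rparr>)"
proof -
  let ?D = "derived \<Gamma> (carrier \<Gamma>)"
  have D: "subgroup ?D \<Gamma>" by (rule derived_is_subgroup[OF order_refl])
  have gD: "group (\<Gamma>\<lparr>carrier := ?D\<rparr>)" by (rule subgroup_imp_group[OF D])
  have "N = {\<one>} \<or> N = ?D" if N: "N \<lhd> \<Gamma>\<lparr>carrier := ?D\<rparr>" for N
  proof (rule disjCI)
    assume ne: "N \<noteq> ?D"
    have N': "subgroup N (\<Gamma>\<lparr>carrier := ?D\<rparr>)"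
      using normal_imp_subgroup[OF N] .
    then have sub: "subgroup N \<Gamma>" by (rule incl_subgroup[OF D])
    have ND: "N \<subseteq> ?D" using subgroup.subset[OF N'] by simp
    have conj: "k \<otimes> h \<otimes> inv k \<in> N" if "k \<in> ?D" "h \<in> N" for k h
      using group.normal_invE(2)[OF gD N, of k h] that m_inv_consistent[OF D] by simp
    have "normalized_by \<Gamma> N ?D"
      unfolding normalized_by_def
    proof (intro ballI equalityI)
      fix k assume k: "k \<in> ?D"
      show "(\<lambda>h. k \<otimes> h \<otimes> inv k) ` N \<subseteq> N" using conj k by blast
      show "N \<subseteq> (\<lambda>h. k \<otimes> h \<otimes> inv k) ` N"
      proof
        fix h assume h: "h \<in> N"
        have c: "k \<in> carrier \<Gamma>" "h \<in> carrier \<Gamma>"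
          using k h subgroup.mem_carrier[OF D] subgroup.mem_carrier[OF sub] by auto
        have "inv k \<otimes> h \<otimes> inv (inv k) \<in> N"
          using conj[OF subgroup.m_inv_closed[OF D k] h] .
        then have "k \<otimes> (inv k \<otimes> h \<otimes> inv (inv k)) \<otimes> inv k \<in> (\<lambda>h. k \<otimes> h \<otimes> inv k) ` N"
          by (rule imageI)
        then show "h \<in> (\<lambda>h. k \<otimes> h \<otimes> inv k) ` N"
          using c by (simp add: cancel_simps)
      qed
    qed
    then show "N = {\<one>}" using derived_subset[OF sub] ne ND by blast
  qed
  then show ?thesis using gD derived_nontrivial unfolding simple_as_group_def by simp
qed

end

section \<open>Compact open $G$-sets\<close>

text \<open>In a compact Hausdorff space quasi-components are connected components, here singletons.
  A clopen set then separates \<open>x\<close> from the compact complement of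
  \<open>U\<close>.\<close>

lemma zero_dimensional:
  assumes "compact_space X" "Hausdorff_space X" "totally_disconnected_space X"
    and U: "openin X U" "x \<in> U"
  shows "\<exists>K. clopenin X K \<and> x \<in> K \<and> K \<subseteq> U"
proof -
  have xX: "x \<in> topspace X" using U openin_subset by blast
  have "quasi_component_of X x = connected_component_of X x"
    using assms(1,2) by (intro quasi_eq_connected_component_of) simp
  then have "connectedin X (quasi_component_of_set X x)"
    by (simp add: connectedin_connected_component_of)
  moreover have "x \<in> quasi_component_of_set X x" using xX by simp
  ultimately have sing: "quasi_component_of_set X x = {x}"
    using assms(3) unfolding totally_disconnected_space_def by blast
  have "{x} \<in> quasi_components_of X"
    unfolding quasi_components_of_def sing[symmetric] using xX by (rule imageI)
  moreover have "compactin X (topspace X - U)"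
    using U(1) assms(1) by (simp add: closedin_compact_space closedin_diff)
  ultimately have "separated_between X {x} (topspace X - U)"
    using separated_between_quasi_component_compact[of "{x}" X "topspace X - U"] U(2)
    by (simp add: disjnt_def)
  then obtain K where K: "closedin X K" "openin X K" "{x} \<subseteq> K" "topspace X - U \<subseteq> topspace X - K"
    unfolding separated_between by blast
  have "K \<subseteq> U" using K(4) openin_subset[OF K(2)] by blast
  with K show ?thesis unfolding clopenin_def by blast
qed

text \<open>A continuous injection from a compact space to a Hausdorff space is a closed map, hence
  a homeomorphism onto its image. This supplies continuous sections of source and range.\<close>

lemma continuous_map_the_inv_into:
  assumes f: "continuous_map X Y f" and "Hausdorff_space Y"
    and V: "compactin X V" and inj: "inj_on f V"
  shows "continuous_map (subtopology Y (f ` V)) X (the_inv_into V f)"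
proof -
  have VX: "V \<subseteq> topspace X" using V by (rule compactin_subset_topspace)
  have fV: "f ` V \<subseteq> topspace Y" using f VX continuous_map_image_subset_topspace by blast
  have c: "continuous_map (subtopology X V) (subtopology Y (f ` V)) f"
    by (rule continuous_map_into_subtopology[OF continuous_map_from_subtopology[OF f]]) auto
  have "closed_map (subtopology X V) (subtopology Y (f ` V)) f"
    using c V assms(2)
    by (intro continuous_imp_closed_map compact_space_subtopology Hausdorff_space_subtopology)
  then have "homeomorphic_map (subtopology X V) (subtopology Y (f ` V)) f"
    using c inj VX fV by (intro bijective_closed_imp_homeomorphic_map) (auto simp: inf_absorb2)
  then obtain g where g: "continuous_map (subtopology Y (f ` V)) (subtopology X V) g"
      "\<forall>x\<in>topspace (subtopology X V). g (f x) = x"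
    unfolding homeomorphic_map_maps homeomorphic_maps_def by blast
  show ?thesis
  proof (rule continuous_map_eq)
    show "continuous_map (subtopology Y (f ` V)) X g"
      using g(1) continuous_map_into_fulltopology by blast
    fix y assume "y \<in> topspace (subtopology Y (f ` V))"
    then obtain x where x: "x \<in> V" "y = f x" by auto
    then have "g (f x) = x" using g(2) VX by auto
    then show "g y = the_inv_into V f y" using x inj by (simp add: the_inv_into_f_f)
  qed
qed

section \<open>Inverses and continuity in topological groupoids\<close>

context topological_groupoid
begin

abbreviation "\<T> \<equiv> arrow_topology G"

lemma units_subset: "units G \<subseteq> arrows G"
  unfolding units_def using rng_closed by blast

lemma rng_in_units [simp]: "g \<in> arrows G \<Longrightarrow> rng G g \<in> units G"
  unfolding units_def by blast

lemma src_in_units [simp]: "g \<in> arrows G \<Longrightarrow> src G g \<in> units G"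
  using rng_in_units[OF src_closed] by (simp add: rng_src)

lemma units_fixed [simp]:
  assumes "x \<in> units G" shows "rng G x = x" "src G x = x"
  using assms unfolding units_def by (auto simp: rng_rng src_rng)

lemma topspace_unit_space [simp]: "topspace (unit_space G) = units G"
  using units_subset by auto

text \<open>With \<open>h = ginv G g\<close> and \<open>k = ginv G h\<close>, associativity gives
  \<open>k = k (h g) = (k h) g = g\<close>.\<close>

lemma ginv_ginv:
  assumes g: "g \<in> arrows G"
  shows "ginv G (ginv G g) = g"
proof -
  let ?h = "ginv G g" let ?k = "ginv G ?h"
  have h: "?h \<in> arrows G" and k: "?k \<in> arrows G" using g ginv_closed by auto
  have kh: "(?k, ?h) \<in> composable G" and hg: "(?h, g) \<in> composable G"
    using g h k by (auto simp: composable_def src_ginv rng_ginv)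
  have "?k = gmult G ?k (src G ?k)" using src_gmult_right[OF k] by simp
  also have "src G ?k = gmult G ?h g" using g h by (simp add: src_ginv rng_ginv gmult_ginv_left)
  also have "gmult G ?k (gmult G ?h g) = gmult G (gmult G ?k ?h) g" using gmult_assoc[OF kh hg] by simp
  also have "gmult G ?k ?h = rng G g" using g h by (simp add: gmult_ginv_left src_ginv)
  also have "gmult G (rng G g) g = g" using g by (rule rng_gmult_left)
  finally show ?thesis .
qed

lemma continuous_map_gmult:
  assumes a: "continuous_map Z \<T> a" and b: "continuous_map Z \<T> b"
    and eq: "\<And>z. z \<in> topspace Z \<Longrightarrow> src G (a z) = rng G (b z)"
  shows "continuous_map Z \<T> (\<lambda>z. gmult G (a z) (b z))"
proof -
  have "continuous_map Z (prod_topology \<T> \<T>) (\<lambda>z. (a z, b z))"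
    using a b by (rule continuous_map_pairedI)
  moreover have "(\<lambda>z. (a z, b z)) \<in> topspace Z \<rightarrow> composable G"
    using eq continuous_map_image_subset_topspace[OF a] continuous_map_image_subset_topspace[OF b]
    by (auto simp: composable_def)
  ultimately have "continuous_map Z (subtopology (prod_topology \<T> \<T>) (composable G)) (\<lambda>z. (a z, b z))"
    by (rule continuous_map_into_subtopology)
  from continuous_map_compose[OF this continuous_gmult] show ?thesis by (simp add: o_def)
qed

text \<open>The range of \<open>g\<close> is the product of \<open>g\<close> with its inverse, and
  both operations are continuous.\<close>

lemma continuous_rng: "continuous_map \<T> \<T> (rng G)"
proof (rule continuous_map_eq)
  show "continuous_map \<T> \<T> (\<lambda>g. gmult G g (ginv G g))"
    by (rule continuous_map_gmult) (use continuous_ginv in \<open>auto simp: rng_ginv\<close>)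
qed (simp add: gmult_ginv_right)

lemma continuous_src: "continuous_map \<T> \<T> (src G)"
proof (rule continuous_map_eq)
  show "continuous_map \<T> \<T> (\<lambda>g. rng G (ginv G g))"
    using continuous_map_compose[OF continuous_ginv continuous_rng] by (simp add: o_def)
qed (simp add: rng_ginv)

lemma gmult_cancel:
  assumes "g \<in> arrows G" "h \<in> arrows G" "src G g = rng G h"
  shows "gmult G (ginv G g) (gmult G g h) = h"
proof -
  have "gmult G (ginv G g) (gmult G g h) = gmult G (gmult G (ginv G g) g) h"
    using assms by (intro gmult_assoc[symmetric]) (auto simp: composable_def ginv_closed src_ginv)
  then show ?thesis using assms by (simp add: gmult_ginv_left rng_gmult_left)
qed

text \<open>Inversion is an involution; reading its images as preimages makes continuity yield
  openness.\<close>

lemma ginv_image_eq: "U \<subseteq> arrows G \<Longrightarrow> ginv G ` U = {g \<in> arrows G. ginv G g \<in> U}"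
  by (force simp: image_iff ginv_ginv ginv_closed subset_iff intro: ginv_ginv[symmetric])

lemma openin_ginv_image: "openin \<T> U \<Longrightarrow> openin \<T> (ginv G ` U)"
  using openin_continuous_map_preimage[OF continuous_ginv] by (simp add: ginv_image_eq openin_subset)

lemma rng_ginv_image: "U \<subseteq> arrows G \<Longrightarrow> rng G ` ginv G ` U = src G ` U"
  unfolding image_image by (intro image_cong refl rng_ginv) blast

lemma src_ginv_image: "U \<subseteq> arrows G \<Longrightarrow> src G ` ginv G ` U = rng G ` U"
  unfolding image_image by (intro image_cong refl src_ginv) blast

lemma compact_open_G_setD:
  assumes "compact_open_G_set G U"
  shows "U \<subseteq> arrows G" "inj_on (rng G) U" "inj_on (src G) U" "compactin \<T> U" "openin \<T> U"
  using assms unfolding compact_open_G_set_def G_set_def by auto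

lemma compact_open_G_set_ginv:
  assumes U: "compact_open_G_set G U"
  shows "compact_open_G_set G (ginv G ` U)"
proof -
  note d = compact_open_G_setD[OF U]
  have "inj_on (rng G) (ginv G ` U)" "inj_on (src G) (ginv G ` U)"
    using d(1-3) by (auto simp: inj_on_def rng_ginv src_ginv subset_iff)
  moreover have "ginv G ` U \<subseteq> arrows G" using d(1) ginv_closed by auto
  ultimately show ?thesis
    using image_compactin[OF d(4) continuous_ginv] openin_ginv_image[OF d(5)]
    by (simp add: compact_open_G_set_def G_set_def)
qed

lemma G_set_map_src:
  assumes "compact_open_G_set G U" "u \<in> U"
  shows "G_set_map G U (src G u) = rng G u"
  using assms compact_open_G_setD(3)[OF assms(1)] unfolding G_set_map_def by (simp add: the_inv_into_f_f)

end

section \<open>Groupoids with an open Cantor unit space\<close>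

locale ample_groupoid = etale_groupoid +
  assumes units_open: "openin (arrow_topology G) (units G)"
    and cantor: "cantor_space (unit_space G)"
begin

definition \<A> :: "'a set set" where
  "\<A> = {A. clopenin (unit_space G) A}"

lemma compact_units: "compact_space (unit_space G)" and Hausdorff_units: "Hausdorff_space (unit_space G)"
  using cantor by (auto simp: cantor_space_def intro: metrizable_imp_Hausdorff_space)

lemma compactin_units: "compactin \<T> (units G)"
  using compact_units units_subset by (simp add: compactin_subspace)

lemma closedin_units: "closedin \<T> (units G)"
  using compactin_imp_closedin[OF Hausdorff compactin_units] .

text \<open>The unit space is open in the arrow space, and closed as a compact subset of a Hausdorff
  space, so clopenness may be tested in either.\<close>

lemma clopen_iff: "A \<in> \<A> \<longleftrightarrow> openin \<T> A \<and> closedin \<T> A \<and> A \<subseteq> units G"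
  unfolding \<A>_def clopenin_def
  using openin_open_subtopology[OF units_open] closedin_closed_subtopology[OF closedin_units] by auto

lemma algebra_clopen: "algebra (units G) \<A>"
  unfolding algebra_iff_Un using units_open closedin_units
  by (auto simp: clopen_iff openin_Un closedin_Un openin_diff closedin_diff)

lemma clopen_between:
  assumes "openin \<T> W" "x \<in> W" "x \<in> units G"
  shows "\<exists>K\<in>\<A>. x \<in> K \<and> K \<subseteq> W"
proof -
  have "openin (unit_space G) (units G \<inter> W)" using assms(1) by (simp add: openin_subtopology_Int2)
  moreover have "totally_disconnected_space (unit_space G)" using cantor by (simp add: cantor_space_def)
  ultimately show ?thesis
    using zero_dimensional[OF compact_units Hausdorff_units, of "units G \<inter> W" x] assms
    unfolding \<A>_def by auto
qed

text \<open>Near each of its points \<open>U\<close> is mapped by a local homeomorphism. Openness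
  then passes from the local image to the unit space and, as the latter is open, to the arrow
  space.\<close>

lemma openin_rng_image:
  assumes U: "openin \<T> U"
  shows "openin \<T> (rng G ` U)"
proof (subst openin_subopen, clarify)
  fix g assume g: "g \<in> U"
  then have "g \<in> arrows G" using U openin_subset by blast
  then obtain N where N: "openin \<T> N" "g \<in> N" "openin (unit_space G) (rng G ` N)"
      and hom: "homeomorphic_map (subtopology \<T> N) (subtopology (unit_space G) (rng G ` N)) (rng G)"
    using local_homeomorphism_rng unfolding local_homeomorphism_def by blast
  have "openin (subtopology \<T> N) (N \<inter> U)" using U by (simp add: openin_subtopology_Int2)
  then have "openin (subtopology (unit_space G) (rng G ` N)) (rng G ` (N \<inter> U))"
    using homeomorphic_imp_open_map[OF hom] unfolding open_map_def by blast
  then have "openin (unit_space G) (rng G ` (N \<inter> U))" using N(3) by (rule openin_trans_full)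
  then have "openin \<T> (rng G ` (N \<inter> U))" using units_open by (rule openin_trans_full)
  then show "\<exists>T. openin \<T> T \<and> rng G g \<in> T \<and> T \<subseteq> rng G ` U" using g N(2) by blast
qed

lemma rng_image_clopen:
  assumes U: "compact_open_G_set G U" shows "rng G ` U \<in> \<A>"
proof -
  note d = compact_open_G_setD[OF U]
  have "closedin \<T> (rng G ` U)"
    using compactin_imp_closedin[OF Hausdorff image_compactin[OF d(4) continuous_rng]] .
  moreover have "rng G ` U \<subseteq> units G" using d(1) by auto
  ultimately show ?thesis using openin_rng_image[OF d(5)] by (simp add: clopen_iff)
qed

lemma src_image_clopen:
  assumes U: "compact_open_G_set G U" shows "src G ` U \<in> \<A>"
  using rng_image_clopen[OF compact_open_G_set_ginv[OF U]] rng_ginv_image compact_open_G_setD(1)[OF U]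
  by simp

lemma compact_open_G_set_subset:
  assumes U: "compact_open_G_set G U" and W: "openin \<T> W" "closedin \<T> W"
  shows "compact_open_G_set G (U \<inter> W)"
proof -
  note d = compact_open_G_setD[OF U]
  have "compactin \<T> (U \<inter> W)" using d(4) W(2) by (rule compact_Int_closedin)
  then show ?thesis
    using d W(1) by (auto simp: compact_open_G_set_def G_set_def intro: inj_on_subset)
qed

lemma compact_open_G_set_restrict_src:
  assumes U: "compact_open_G_set G U" and A: "A \<in> \<A>"
  shows "compact_open_G_set G {u \<in> U. src G u \<in> A}"
proof -
  have "{u \<in> U. src G u \<in> A} = U \<inter> {u \<in> arrows G. src G u \<in> A}"
    using compact_open_G_setD(1)[OF U] by auto
  moreover have "openin \<T> {u \<in> arrows G. src G u \<in> A}" "closedin \<T> {u \<in> arrows G. src G u \<in> A}"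
    using A openin_continuous_map_preimage[OF continuous_src] closedin_continuous_map_preimage[OF continuous_src]
    by (auto simp: clopen_iff)
  ultimately show ?thesis using compact_open_G_set_subset[OF U] by simp
qed

lemma compact_open_G_set_clopen:
  assumes A: "A \<in> \<A>" shows "compact_open_G_set G A"
proof -
  have "A \<subseteq> units G" using A by (simp add: clopen_iff)
  then have "inj_on (rng G) A" "inj_on (src G) A" by (auto simp: inj_on_def subset_iff)
  moreover have "compactin \<T> A" using closed_compactin[OF compactin_units] A by (simp add: clopen_iff)
  ultimately show ?thesis
    using A units_subset by (auto simp: clopen_iff compact_open_G_set_def G_set_def)
qed

lemma clopen_image_units: "A \<in> \<A> \<Longrightarrow> rng G ` A = A" "A \<in> \<A> \<Longrightarrow> src G ` A = A"
  by (auto simp: clopen_iff subset_iff image_iff)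

lemma compact_open_G_set_Un:
  assumes U: "compact_open_G_set G U" and V: "compact_open_G_set G V"
    and "src G ` U \<inter> src G ` V = {}" "rng G ` U \<inter> rng G ` V = {}"
  shows "compact_open_G_set G (U \<union> V)"
proof -
  have "inj_on (rng G) (U \<union> V)" "inj_on (src G) (U \<union> V)"
    using compact_open_G_setD(2,3)[OF U] compact_open_G_setD(2,3)[OF V] assms(3,4)
    by (auto simp: inj_on_Un)
  then show ?thesis
    using U V by (simp add: compact_open_G_set_def G_set_def compactin_Un openin_Un)
qed

section \<open>Products of compact open G-sets\<close>

definition setmult :: "'a set \<Rightarrow> 'a set \<Rightarrow> 'a set" where
  "setmult V U = {gmult G v u | v u. v \<in> V \<and> u \<in> U \<and> src G v = rng G u}"

lemma setmultI: "v \<in> V \<Longrightarrow> u \<in> U \<Longrightarrow> src G v = rng G u \<Longrightarrow> gmult G v u \<in> setmult V U"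
  unfolding setmult_def by blast

text \<open>By injectivity of the source on \<open>V\<close>, each \<open>u\<close> in
  \<open>U\<close> has exactly one partner in \<open>V\<close>, depending continuously on
  \<open>u\<close>. The product is thus a continuous image of \<open>U\<close>.\<close>

lemma compact_setmult:
  assumes V: "compact_open_G_set G V" and U: "compact_open_G_set G U" and sub: "rng G ` U \<subseteq> src G ` V"
  shows "compactin \<T> (setmult V U)"
proof -
  note dV = compact_open_G_setD[OF V] and dU = compact_open_G_setD[OF U]
  define s where "s = the_inv_into V (src G)"
  have s: "s (src G v) = v" if "v \<in> V" for v
    using that dV(3) by (simp add: s_def the_inv_into_f_f)
  have cs: "continuous_map (subtopology \<T> (src G ` V)) \<T> s"
    unfolding s_def by (rule continuous_map_the_inv_into[OF continuous_src Hausdorff dV(4,3)])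
  have "continuous_map (subtopology \<T> U) (subtopology \<T> (src G ` V)) (rng G)"
    using sub by (intro continuous_map_into_subtopology continuous_map_from_subtopology continuous_rng) auto
  then have c1: "continuous_map (subtopology \<T> U) \<T> (\<lambda>u. s (rng G u))"
    using continuous_map_compose[OF _ cs] by (simp add: o_def)
  have "continuous_map (subtopology \<T> U) \<T> (\<lambda>u. gmult G (s (rng G u)) u)"
  proof (rule continuous_map_gmult[OF c1 continuous_map_from_subtopology])
    show "continuous_map \<T> \<T> (\<lambda>u. u)" by simp
    fix u assume "u \<in> topspace (subtopology \<T> U)"
    then obtain v where "v \<in> V" "rng G u = src G v" using sub by auto
    then show "src G (s (rng G u)) = rng G u" using s by simp
  qed
  moreover have "compactin (subtopology \<T> U) U" using dU(4) by (simp add: compactin_subtopology)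
  ultimately have "compactin \<T> ((\<lambda>u. gmult G (s (rng G u)) u) ` U)" by (rule image_compactin[rotated])
  moreover have "(\<lambda>u. gmult G (s (rng G u)) u) ` U = setmult V U"
  proof
    show "(\<lambda>u. gmult G (s (rng G u)) u) ` U \<subseteq> setmult V U"
    proof clarify
      fix u assume u: "u \<in> U"
      then obtain v where "v \<in> V" "rng G u = src G v" using sub by auto
      then show "gmult G (s (rng G u)) u \<in> setmult V U" using s u by (simp add: setmultI)
    qed
    show "setmult V U \<subseteq> (\<lambda>u. gmult G (s (rng G u)) u) ` U"
    proof
      fix k assume "k \<in> setmult V U"
      then obtain v u where k: "v \<in> V" "u \<in> U" "src G v = rng G u" "k = gmult G v u"
        unfolding setmult_def by blast
      then have "gmult G (s (rng G u)) u = k" using s[of v] by simp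
      then show "k \<in> (\<lambda>u. gmult G (s (rng G u)) u) ` U" using k(2) by blast
    qed
  qed
  ultimately show ?thesis by simp
qed

text \<open>\<open>k\<close> lies in \<open>V U\<close> iff \<open>v\<inverse> k \<in> U\<close> for the unique \<open>v \<in> V\<close> with the range of \<open>k\<close>;
  this \<open>v\<close> depends continuously on \<open>k\<close>.\<close>

lemma open_setmult:
  assumes V: "compact_open_G_set G V" and U: "compact_open_G_set G U"
  shows "openin \<T> (setmult V U)"
proof -
  note dV = compact_open_G_setD[OF V] and dU = compact_open_G_setD[OF U]
  define s where "s = the_inv_into V (rng G)"
  have s: "s (rng G v) = v" if "v \<in> V" for v
    using that dV(2) by (simp add: s_def the_inv_into_f_f)
  have cs: "continuous_map (subtopology \<T> (rng G ` V)) \<T> s"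
    unfolding s_def by (rule continuous_map_the_inv_into[OF continuous_rng Hausdorff dV(4,2)])
  define R where "R = {k \<in> arrows G. rng G k \<in> rng G ` V}"
  have oR: "openin \<T> R"
    unfolding R_def by (rule openin_continuous_map_preimage[OF continuous_rng openin_rng_image[OF dV(5)]])
  have "continuous_map (subtopology \<T> R) (subtopology \<T> (rng G ` V)) (rng G)"
    by (intro continuous_map_into_subtopology continuous_map_from_subtopology continuous_rng) (auto simp: R_def)
  then have "continuous_map (subtopology \<T> R) \<T> (\<lambda>k. s (rng G k))"
    using continuous_map_compose[OF _ cs] by (simp add: o_def)
  then have c1: "continuous_map (subtopology \<T> R) \<T> (\<lambda>k. ginv G (s (rng G k)))"
    using continuous_map_compose[OF _ continuous_ginv] by (simp add: o_def)
  have "continuous_map (subtopology \<T> R) \<T> (\<lambda>k. gmult G (ginv G (s (rng G k))) k)"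
  proof (rule continuous_map_gmult[OF c1 continuous_map_from_subtopology])
    show "continuous_map \<T> \<T> (\<lambda>u. u)" by simp
    fix k assume "k \<in> topspace (subtopology \<T> R)"
    then obtain v where "v \<in> V" "rng G k = rng G v" by (auto simp: R_def)
    then show "src G (ginv G (s (rng G k))) = rng G k" using s dV(1) by (auto simp: src_ginv)
  qed
  then have "openin (subtopology \<T> R) {k \<in> topspace (subtopology \<T> R). gmult G (ginv G (s (rng G k))) k \<in> U}"
    using dU(5) by (rule openin_continuous_map_preimage)
  then have "openin \<T> {k \<in> topspace (subtopology \<T> R). gmult G (ginv G (s (rng G k))) k \<in> U}"
    using oR by (rule openin_trans_full)
  moreover have "{k \<in> topspace (subtopology \<T> R). gmult G (ginv G (s (rng G k))) k \<in> U} = setmult V U" (is "?L = _")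
  proof
    show "?L \<subseteq> setmult V U"
    proof
      fix k assume "k \<in> ?L"
      then obtain v where v: "v \<in> V" "rng G k = rng G v" and k: "k \<in> arrows G"
          and u: "gmult G (ginv G (s (rng G k))) k \<in> U"
        by (auto simp: R_def)
      have va: "v \<in> arrows G" using v dV by blast
      have u': "gmult G (ginv G v) k \<in> U" using u v s by simp
      have comp: "(ginv G v, k) \<in> composable G"
        using va k v by (auto simp: composable_def ginv_closed src_ginv)
      have "gmult G v (gmult G (ginv G v) k) = k"
        using gmult_cancel[of "ginv G v" k] va k v by (simp add: ginv_closed ginv_ginv src_ginv)
      moreover have "src G v = rng G (gmult G (ginv G v) k)"
        using rng_gmult[OF comp] va by (simp add: rng_ginv)
      ultimately show "k \<in> setmult V U" using setmultI[OF v(1) u'] by simp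
    qed
    show "setmult V U \<subseteq> ?L"
    proof
      fix k assume "k \<in> setmult V U"
      then obtain v u where k: "v \<in> V" "u \<in> U" "src G v = rng G u" "k = gmult G v u"
        unfolding setmult_def by blast
      then have vu: "v \<in> arrows G" "u \<in> arrows G" using dV dU by auto
      then have comp: "(v, u) \<in> composable G" using k by (simp add: composable_def)
      have "rng G k = rng G v" "k \<in> arrows G" using rng_gmult[OF comp] gmult_closed[OF comp] k by auto
      then show "k \<in> ?L" using k s gmult_cancel[OF vu k(3)] by (auto simp: R_def)
    qed
  qed
  ultimately show ?thesis by simp
qed

text \<open>The source of a product determines \<open>u\<close>, and then
  \<open>rng G u = src G v\<close> determines \<open>v\<close>; the range works symmetrically. The
  hypothesis \<open>sub\<close> gives every \<open>u\<close> a partner, so no source is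
  lost.\<close>

lemma compact_open_G_set_mult:
  assumes V: "compact_open_G_set G V" and U: "compact_open_G_set G U" and sub: "rng G ` U \<subseteq> src G ` V"
  shows "compact_open_G_set G (setmult V U)" (is ?cog)
    and "src G ` setmult V U = src G ` U"
    and "rng G ` setmult V U \<subseteq> rng G ` V"
proof -
  note dV = compact_open_G_setD[OF V] and dU = compact_open_G_setD[OF U]
  have ex: "\<exists>v\<in>V. \<exists>u\<in>U. src G v = rng G u \<and> k = gmult G v u \<and> k \<in> arrows G \<and> src G k = src G u \<and> rng G k = rng G v"
    if kVU: "k \<in> setmult V U" for k
  proof -
    obtain v u where k: "v \<in> V" "u \<in> U" "src G v = rng G u" "k = gmult G v u"
      using kVU unfolding setmult_def by blast
    then have "(v, u) \<in> composable G" using dV dU by (auto simp: composable_def)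
    then show ?thesis using k rng_gmult src_gmult gmult_closed by blast
  qed
  have "inj_on (src G) (setmult V U)"
  proof (rule inj_onI)
    fix k k' assume kk: "k \<in> setmult V U" "k' \<in> setmult V U" "src G k = src G k'"
    obtain v u where 1: "v \<in> V" "u \<in> U" "src G v = rng G u" "k = gmult G v u" "src G k = src G u"
      using ex[OF kk(1)] by blast
    obtain v' u' where 2: "v' \<in> V" "u' \<in> U" "src G v' = rng G u'" "k' = gmult G v' u'" "src G k' = src G u'"
      using ex[OF kk(2)] by blast
    have "src G u = src G u'" using 1(5) 2(5) kk(3) by simp
    then have u: "u = u'" using inj_onD[OF dU(3)] 1(2) 2(2) by blast
    then have "v = v'" using inj_onD[OF dV(3) _ 1(1) 2(1)] 1(3) 2(3) by simp
    then show "k = k'" using u 1(4) 2(4) by simp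
  qed
  moreover have "inj_on (rng G) (setmult V U)"
  proof (rule inj_onI)
    fix k k' assume kk: "k \<in> setmult V U" "k' \<in> setmult V U" "rng G k = rng G k'"
    obtain v u where 1: "v \<in> V" "u \<in> U" "src G v = rng G u" "k = gmult G v u" "rng G k = rng G v"
      using ex[OF kk(1)] by blast
    obtain v' u' where 2: "v' \<in> V" "u' \<in> U" "src G v' = rng G u'" "k' = gmult G v' u'" "rng G k' = rng G v'"
      using ex[OF kk(2)] by blast
    have "rng G v = rng G v'" using 1(5) 2(5) kk(3) by simp
    then have v: "v = v'" using inj_onD[OF dV(2)] 1(1) 2(1) by blast
    then have "u = u'" using inj_onD[OF dU(2) _ 1(2) 2(2)] 1(3) 2(3) by simp
    then show "k = k'" using v 1(4) 2(4) by simp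
  qed
  moreover have "setmult V U \<subseteq> arrows G" using ex by blast
  ultimately show ?cog
    using compact_setmult[OF V U sub] open_setmult[OF V U]
    by (simp add: compact_open_G_set_def G_set_def)
  show "rng G ` setmult V U \<subseteq> rng G ` V" using ex by blast
  show "src G ` setmult V U = src G ` U"
  proof
    show "src G ` setmult V U \<subseteq> src G ` U" using ex by blast
    show "src G ` U \<subseteq> src G ` setmult V U"
    proof clarify
      fix u assume u: "u \<in> U"
      then obtain v where v: "v \<in> V" "rng G u = src G v" using sub by auto
      then have "(v, u) \<in> composable G" using u dV dU by (auto simp: composable_def)
      then have "src G (gmult G v u) = src G u" by (rule src_gmult)
      moreover have "gmult G v u \<in> setmult V U" using setmultI[OF v(1) u] v(2) by simp
      ultimately show "src G u \<in> src G ` setmult V U" by (metis imageI)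
    qed
  qed
qed

end

text \<open>Compact open G-sets exist around every arrow, with source and range inside prescribed
  clopen neighbourhoods.\<close>

lemma (in ample_groupoid) compact_open_G_set_at:
  assumes g: "g \<in> arrows G" and A: "A \<in> \<A>" "src G g \<in> A" and B: "B \<in> \<A>" "rng G g \<in> B"
  shows "\<exists>W. compact_open_G_set G W \<and> g \<in> W \<and> src G ` W \<subseteq> A \<and> rng G ` W \<subseteq> B"
proof -
  have local: "\<exists>N. openin \<T> N \<and> h \<in> N \<and>
      homeomorphic_map (subtopology \<T> N) (subtopology (unit_space G) (rng G ` N)) (rng G)"
    if "h \<in> arrows G" for h
    using local_homeomorphism_rng that unfolding local_homeomorphism_def by blast
  obtain N where N: "openin \<T> N" "g \<in> N"
      and hom: "homeomorphic_map (subtopology \<T> N) (subtopology (unit_space G) (rng G ` N)) (rng G)"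
    using local[OF g] by blast
  \<comment> \<open>Injectivity of the range near the inverse arrow becomes injectivity of the
    source near \<open>g\<close>.\<close>
  obtain M where M: "openin \<T> M" "ginv G g \<in> M"
      and homM: "homeomorphic_map (subtopology \<T> M) (subtopology (unit_space G) (rng G ` M)) (rng G)"
    using local[OF ginv_closed[OF g]] by blast
  have NM: "N \<subseteq> arrows G" "M \<subseteq> arrows G" using N(1) M(1) openin_subset by auto
  have injN: "inj_on (rng G) N" and "inj_on (rng G) M"
    using hom homM NM by (auto simp: homeomorphic_eq_everything_map inf_absorb2)
  then have injM: "inj_on (src G) (ginv G ` M)"
    using NM by (auto simp: inj_on_def src_ginv subset_iff)
  have gM: "g \<in> ginv G ` M" using imageI[OF M(2), of "ginv G"] by (simp add: ginv_ginv g)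
  define P where "P = N \<inter> ginv G ` M \<inter> {h \<in> arrows G. src G h \<in> A} \<inter> {h \<in> arrows G. rng G h \<in> B}"
  have oP: "openin \<T> P"
    unfolding P_def using A B N openin_ginv_image[OF M(1)]
    by (intro openin_Int openin_continuous_map_preimage[OF continuous_src] openin_continuous_map_preimage[OF continuous_rng])
      (auto simp: clopen_iff)
  have gP: "g \<in> P" using g A B N gM by (auto simp: P_def)
  \<comment> \<open>The part \<open>W\<close> of \<open>P\<close> over \<open>K\<close> corresponds
    to the compact set \<open>K\<close> under the homeomorphism on \<open>N\<close>, and is
    therefore compact.\<close>
  obtain K where K: "K \<in> \<A>" "rng G g \<in> K" "K \<subseteq> rng G ` P"
    using clopen_between[OF openin_rng_image[OF oP]] gP g by (metis imageI rng_in_units)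
  define W where "W = P \<inter> {h \<in> arrows G. rng G h \<in> K}"
  have WN: "W \<subseteq> N" by (auto simp: W_def P_def)
  have rW: "rng G ` W = K" using K(3) oP openin_subset by (fastforce simp: W_def)
  have "compactin \<T> K" using compact_open_G_setD(4)[OF compact_open_G_set_clopen[OF K(1)]] .
  then have "compactin (subtopology (unit_space G) (rng G ` N)) (rng G ` W)"
    using rW WN K(1) by (auto simp: compactin_subtopology clopen_iff)
  then have "compactin (subtopology \<T> N) W"
    using homeomorphic_map_compactness[OF hom, of W] WN NM by (auto simp: inf_absorb2)
  then have "compactin \<T> W" by (simp add: compactin_subtopology)
  moreover have "openin \<T> W"
    unfolding W_def using oP openin_continuous_map_preimage[OF continuous_rng] K(1)
    by (auto simp: clopen_iff)
  moreover have "inj_on (rng G) W" "inj_on (src G) W"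
    using inj_on_subset[OF injN WN] inj_on_subset[OF injM, of W] by (auto simp: W_def P_def)
  moreover have "W \<subseteq> arrows G" by (auto simp: W_def)
  ultimately have "compact_open_G_set G W" by (simp add: compact_open_G_set_def G_set_def)
  moreover have "g \<in> W" using gP g K by (simp add: W_def)
  ultimately show ?thesis by (auto simp: W_def P_def)
qed

section \<open>The topological full group\<close>

context ample_groupoid
begin

abbreviation "\<Gamma> \<equiv> topological_full_group G"

text \<open>The map is the continuous section of the source followed by the range map, and a
  continuous bijection of a compact Hausdorff space is a homeomorphism.\<close>

lemma G_set_map_full:
  assumes U: "compact_open_G_set G U" and s: "src G ` U = units G" and r: "rng G ` U = units G"
  shows "bij_betw (G_set_map G U) (units G) (units G)"
    and "homeomorphic_map (unit_space G) (unit_space G) (G_set_map G U)"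
    and "G_set_map G U \<in> extensional (units G)"
proof -
  let ?f = "G_set_map G U"
  note d = compact_open_G_setD[OF U]
  have img: "?f ` units G = units G"
  proof -
    have "?f ` src G ` U = rng G ` U"
      unfolding image_image using G_set_map_src[OF U] by (rule image_cong[OF refl])
    then show ?thesis by (simp add: s r)
  qed
  moreover have inj: "inj_on ?f (units G)"
  proof (rule inj_onI)
    fix x y assume "x \<in> units G" "y \<in> units G" and eq: "?f x = ?f y"
    then obtain u v where uv: "u \<in> U" "v \<in> U" "x = src G u" "y = src G v"
      using s by (metis imageE)
    then have "rng G u = rng G v" using eq G_set_map_src[OF U] by simp
    then have "u = v" using inj_onD[OF d(2)] uv by blast
    then show "x = y" using uv by simp
  qed
  ultimately show "bij_betw ?f (units G) (units G)" by (simp add: bij_betw_def)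
  show "?f \<in> extensional (units G)" by (simp add: G_set_map_def s)
  have "continuous_map (unit_space G) \<T> (the_inv_into U (src G))"
    using continuous_map_the_inv_into[OF continuous_src Hausdorff d(4,3)] by (simp add: s)
  then have "continuous_map (unit_space G) \<T> (rng G \<circ> the_inv_into U (src G))"
    using continuous_rng by (rule continuous_map_compose)
  then have "continuous_map (unit_space G) \<T> ?f"
    by (rule continuous_map_eq) (use units_subset in \<open>auto simp: G_set_map_def s\<close>)
  then have c: "continuous_map (unit_space G) (unit_space G) ?f"
    by (rule continuous_map_into_subtopology) (use img in auto)
  show "homeomorphic_map (unit_space G) (unit_space G) ?f"
    using c continuous_imp_closed_map[OF c compact_units Hausdorff_units] img inj
    by (intro bijective_closed_imp_homeomorphic_map) (simp_all only: topspace_unit_space)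
qed

lemma full_group_carrier:
  "f \<in> carrier \<Gamma> \<longleftrightarrow>
     (\<exists>U. compact_open_G_set G U \<and> src G ` U = units G \<and> rng G ` U = units G \<and> f = G_set_map G U)"
  unfolding topological_full_group_def using G_set_map_full by auto

lemma full_group_Bij: "carrier \<Gamma> \<subseteq> Bij (units G)"
  unfolding Bij_def using G_set_map_full by (auto simp: full_group_carrier)

lemma full_groupE:
  assumes "f \<in> carrier \<Gamma>"
  obtains U where "compact_open_G_set G U" "src G ` U = units G" "rng G ` U = units G"
    "\<And>u. u \<in> U \<Longrightarrow> f (src G u) = rng G u"
  using assms G_set_map_src unfolding full_group_carrier by blast

text \<open>Surjectivity of \<open>f\<close> forces \<open>U\<close> to have full range, and
  extensionality identifies \<open>f\<close> with \<open>G_set_map G U\<close>.\<close>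

lemma full_groupI:
  assumes U: "compact_open_G_set G U" and s: "src G ` U = units G" and f: "f \<in> Bij (units G)"
    and fU: "\<And>u. u \<in> U \<Longrightarrow> f (src G u) = rng G u"
  shows "f \<in> carrier \<Gamma>"
proof -
  have "rng G ` U = f ` src G ` U"
    unfolding image_image using fU by (intro image_cong refl) simp
  then have r: "rng G ` U = units G" using s f by (simp add: Bij_def bij_betw_def)
  have "f = G_set_map G U"
  proof (rule extensionalityI)
    show "f \<in> extensional (units G)" using f by (simp add: Bij_def)
    show "G_set_map G U \<in> extensional (units G)" by (rule G_set_map_full(3)[OF U s r])
    fix x assume "x \<in> units G"
    then obtain u where "u \<in> U" "x = src G u" using s by (metis imageE)
    then show "f x = G_set_map G U x" using fU G_set_map_src[OF U] by simp
  qed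
  then show ?thesis using U s r full_group_carrier by blast
qed

text \<open>The identity, inverses and composites are realised by the unit space, the inverse G-set
  and \<open>setmult\<close>.\<close>

lemma full_group_subgroup: "subgroup (carrier \<Gamma>) (BijGroup (units G))"
proof (rule group.subgroupI[OF group_BijGroup])
  show "carrier \<Gamma> \<subseteq> carrier (BijGroup (units G))" using full_group_Bij by (simp add: BijGroup_def)
  have X: "units G \<in> \<A>" using units_open closedin_units by (simp add: clopen_iff)
  have "(\<lambda>x\<in>units G. x) \<in> carrier \<Gamma>"
    by (rule full_groupI[OF compact_open_G_set_clopen[OF X] clopen_image_units(2)[OF X] id_Bij]) simp
  then show "carrier \<Gamma> \<noteq> {}" by blast
next
  fix f assume f: "f \<in> carrier \<Gamma>"
  obtain U where U: "compact_open_G_set G U" "src G ` U = units G" "rng G ` U = units G"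
      and fU: "\<And>u. u \<in> U \<Longrightarrow> f (src G u) = rng G u"
    using full_groupE[OF f] by blast
  note d = compact_open_G_setD(1)[OF U(1)]
  have fB: "f \<in> Bij (units G)" using f full_group_Bij by blast
  have "(\<lambda>x\<in>units G. inv_into (units G) f x) \<in> carrier \<Gamma>"
  proof (rule full_groupI[OF compact_open_G_set_ginv[OF U(1)] _ restrict_inv_into_Bij[OF fB]])
    show "src G ` ginv G ` U = units G" using src_ginv_image[OF d] U(3) by simp
    fix v assume "v \<in> ginv G ` U"
    then obtain u where u: "u \<in> U" "v = ginv G u" by blast
    then have ua: "u \<in> arrows G" using d by blast
    have "inv_into (units G) f (rng G u) = src G u"
      using fB fU[OF u(1)] ua by (intro inv_into_f_eq) (auto simp: Bij_def bij_betw_def)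
    then show "(\<lambda>x\<in>units G. inv_into (units G) f x) (src G v) = rng G v"
      using u ua by (simp add: src_ginv rng_ginv)
  qed
  then show "inv\<^bsub>BijGroup (units G)\<^esub> f \<in> carrier \<Gamma>" using inv_BijGroup[OF fB] by simp
next
  fix f g assume f: "f \<in> carrier \<Gamma>" and g: "g \<in> carrier \<Gamma>"
  obtain V where V: "compact_open_G_set G V" "src G ` V = units G" "rng G ` V = units G"
      and fV: "\<And>u. u \<in> V \<Longrightarrow> f (src G u) = rng G u"
    using full_groupE[OF f] by blast
  obtain U where U: "compact_open_G_set G U" "src G ` U = units G" "rng G ` U = units G"
      and gU: "\<And>u. u \<in> U \<Longrightarrow> g (src G u) = rng G u"
    using full_groupE[OF g] by blast
  have B: "f \<in> Bij (units G)" "g \<in> Bij (units G)" using f g full_group_Bij by auto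
  have sub: "rng G ` U \<subseteq> src G ` V" using U V by simp
  have "compose (units G) f g \<in> carrier \<Gamma>"
  proof (rule full_groupI[OF compact_open_G_set_mult(1)[OF V(1) U(1) sub] _ compose_Bij[OF B]])
    show "src G ` setmult V U = units G"
      using compact_open_G_set_mult(2)[OF V(1) U(1) sub] U(2) by simp
    fix w assume "w \<in> setmult V U"
    then obtain v u where w: "v \<in> V" "u \<in> U" "src G v = rng G u" "w = gmult G v u"
      unfolding setmult_def by blast
    have a: "v \<in> arrows G" "u \<in> arrows G"
      using w compact_open_G_setD(1)[OF V(1)] compact_open_G_setD(1)[OF U(1)] by auto
    then have "(v, u) \<in> composable G" using w by (simp add: composable_def)
    then have "src G w = src G u" "rng G w = rng G v" using w src_gmult rng_gmult by auto
    moreover have "f (g (src G u)) = rng G v" using gU[OF w(2)] fV[OF w(1)] w(3) by simp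
    ultimately show "compose (units G) f g (src G w) = rng G w" using a by (simp add: compose_def)
  qed
  then show "f \<otimes>\<^bsub>BijGroup (units G)\<^esub> g \<in> carrier \<Gamma>" using B by (simp add: BijGroup_def)
qed

lemma full_group_eq: "\<Gamma> = BijGroup (units G)\<lparr>carrier := carrier \<Gamma>\<rparr>"
  by (simp add: topological_full_group_def)

lemma group_full_group: "group \<Gamma>"
  using subgroup.subgroup_is_group[OF full_group_subgroup group_BijGroup] full_group_eq by simp

lemma full_group_mult:
  assumes "f \<in> carrier \<Gamma>" "g \<in> carrier \<Gamma>" "x \<in> units G"
  shows "(f \<otimes>\<^bsub>\<Gamma>\<^esub> g) x = f (g x)"
proof -
  have "mult \<Gamma> = mult (BijGroup (units G))" by (simp add: topological_full_group_def)
  then show ?thesis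
    using assms full_group_Bij by (simp add: BijGroup_def subset_iff compose_def)
qed

text \<open>The G-set is \<open>U\<close> with its inverse and the remaining units. Disjointness of
  source and range of \<open>U\<close> makes the three pieces have disjoint sources and disjoint
  ranges.\<close>

lemma full_group_swap:
  assumes U: "compact_open_G_set G U" and disj: "src G ` U \<inter> rng G ` U = {}"
  shows "\<exists>s\<in>carrier \<Gamma>. (\<forall>u\<in>U. s (src G u) = rng G u) \<and>
           (\<forall>x\<in>units G - (src G ` U \<union> rng G ` U). s x = x)"
proof -
  interpret algebra "units G" \<A> by (rule algebra_clopen)
  note d = compact_open_G_setD(1)[OF U]
  define C where "C = units G - (src G ` U \<union> rng G ` U)"
  have C: "C \<in> \<A>" unfolding C_def using src_image_clopen[OF U] rng_image_clopen[OF U] by auto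
  have 1: "compact_open_G_set G (U \<union> ginv G ` U)"
    using compact_open_G_set_Un[OF U compact_open_G_set_ginv[OF U]] disj
    unfolding rng_ginv_image[OF d] src_ginv_image[OF d] by blast
  have im: "src G ` (U \<union> ginv G ` U) = src G ` U \<union> rng G ` U" "rng G ` (U \<union> ginv G ` U) = src G ` U \<union> rng G ` U"
    unfolding image_Un rng_ginv_image[OF d] src_ginv_image[OF d] by blast+
  define W where "W = U \<union> ginv G ` U \<union> C"
  have W: "compact_open_G_set G W"
    unfolding W_def using clopen_image_units[OF C] im
    by (intro compact_open_G_set_Un[OF 1 compact_open_G_set_clopen[OF C]]) (auto simp: C_def)
  have sr: "src G ` U \<subseteq> units G" "rng G ` U \<subseteq> units G" using d by auto
  have "src G ` W = src G ` (U \<union> ginv G ` U) \<union> C" "rng G ` W = src G ` (U \<union> ginv G ` U) \<union> C"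
    unfolding W_def using im clopen_image_units[OF C] by (simp_all add: image_Un)
  then have full: "src G ` W = units G" "rng G ` W = units G"
    using im sr by (auto simp: C_def)
  have "G_set_map G W \<in> carrier \<Gamma>" using W full full_group_carrier by blast
  moreover have "G_set_map G W (src G u) = rng G u" if "u \<in> U" for u
    using G_set_map_src[OF W] that by (simp add: W_def)
  moreover have "G_set_map G W x = x" if "x \<in> C" for x
    using G_set_map_src[OF W, of x] that units_fixed[of x] by (simp add: W_def C_def)
  ultimately show ?thesis unfolding C_def by blast
qed

lemma full_group_image_restrict:
  assumes U: "compact_open_G_set G U" "src G ` U = units G" and fU: "\<And>u. u \<in> U \<Longrightarrow> f (src G u) = rng G u"
    and A: "A \<in> \<A>"
  shows "src G ` {u \<in> U. src G u \<in> A} = A" "rng G ` {u \<in> U. src G u \<in> A} = f ` A"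
proof -
  have "A \<subseteq> src G ` U" using A U(2) by (simp add: clopen_iff)
  then show s: "src G ` {u \<in> U. src G u \<in> A} = A" by auto
  have "f ` src G ` {u \<in> U. src G u \<in> A} = rng G ` {u \<in> U. src G u \<in> A}"
    unfolding image_image using fU by (intro image_cong refl) simp
  then show "rng G ` {u \<in> U. src G u \<in> A} = f ` A" using s by simp
qed

end

section \<open>Comparison of clopen sets and existence of swaps\<close>

locale purely_infinite_minimal_groupoid = ample_groupoid +
  assumes purely_infinite: "purely_infinite G"
    and minimal: "minimal_groupoid G"
begin

text \<open>The given G-sets may overlap in source and in range. Source overlaps are cut away, and
  two disjoint copies of \<open>B\<close> inside \<open>B\<close> make room for both ranges at each
  induction step.\<close>

lemma compare_finite:
  assumes "finite \<F>" "B \<in> \<A>" "\<And>W. W \<in> \<F> \<Longrightarrow> compact_open_G_set G W \<and> rng G ` W \<subseteq> B"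
  shows "\<exists>U. compact_open_G_set G U \<and> src G ` U = (\<Union>W\<in>\<F>. src G ` W) \<and> rng G ` U \<subseteq> B"
  using assms(1,3)
proof (induction \<F> rule: finite_induct)
  case empty
  have "{} \<in> \<A>" by (simp add: clopen_iff)
  then show ?case using compact_open_G_set_clopen by fastforce
next
  case (insert W \<F>)
  interpret algebra "units G" \<A> by (rule algebra_clopen)
  obtain U where U: "compact_open_G_set G U" "src G ` U = (\<Union>W\<in>\<F>. src G ` W)" "rng G ` U \<subseteq> B"
    using insert by auto
  have W: "compact_open_G_set G W" "rng G ` W \<subseteq> B" using insert.prems by auto
  define W' where "W' = {w \<in> W. src G w \<in> units G - src G ` U}"
  have W': "compact_open_G_set G W'"
    unfolding W'_def using src_image_clopen[OF U(1)] by (intro compact_open_G_set_restrict_src[OF W(1)]) auto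
  have sW': "src G ` W' = src G ` W - src G ` U"
    using compact_open_G_setD(1)[OF W(1)] by (auto simp: W'_def)
  have rW': "rng G ` W' \<subseteq> B" using W(2) by (auto simp: W'_def)
  \<comment> \<open>\<open>V1\<close> compresses the G-set built so far and \<open>V2\<close> the
    new piece \<open>W'\<close>.\<close>
  have "properly_infinite G B"
    using purely_infinite \<open>B \<in> \<A>\<close> by (simp add: \<A>_def purely_infinite_def)
  then obtain V1 V2 where V: "compact_open_G_set G V1" "compact_open_G_set G V2" "src G ` V1 = B" "src G ` V2 = B"
      "rng G ` V1 \<union> rng G ` V2 \<subseteq> B" "rng G ` V1 \<inter> rng G ` V2 = {}"
    unfolding properly_infinite_def by (elim exE conjE) (rule that)
  have s1: "rng G ` U \<subseteq> src G ` V1" and s2: "rng G ` W' \<subseteq> src G ` V2" using U(3) rW' V by auto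
  note m1 = compact_open_G_set_mult[OF V(1) U(1) s1] and m2 = compact_open_G_set_mult[OF V(2) W' s2]
  have "src G ` setmult V1 U \<inter> src G ` setmult V2 W' = {}" unfolding m1(2) m2(2) sW' by blast
  moreover have "rng G ` setmult V1 U \<inter> rng G ` setmult V2 W' = {}" using m1(3) m2(3) V(6) by blast
  ultimately have "compact_open_G_set G (setmult V1 U \<union> setmult V2 W')"
    by (rule compact_open_G_set_Un[OF m1(1) m2(1)])
  moreover have "src G ` (setmult V1 U \<union> setmult V2 W') = (\<Union>W\<in>insert W \<F>. src G ` W)"
    unfolding image_Un m1(2) m2(2) sW' using U(2) by auto
  moreover have "rng G ` (setmult V1 U \<union> setmult V2 W') \<subseteq> B"
    unfolding image_Un using m1(3) m2(3) V(5) by blast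
  ultimately show ?case by blast
qed

text \<open>By minimality every point of \<open>A\<close> has an arrow into \<open>B\<close>.
  Compact open G-sets around such arrows have sources covering \<open>A\<close>, and finitely many
  suffice by compactness.\<close>

lemma compare:
  assumes A: "A \<in> \<A>" and B: "B \<in> \<A>" "B \<noteq> {}"
  shows "\<exists>U. compact_open_G_set G U \<and> src G ` U = A \<and> rng G ` U \<subseteq> B"
proof -
  define \<W> where "\<W> = {W. compact_open_G_set G W \<and> src G ` W \<subseteq> A \<and> rng G ` W \<subseteq> B}"
  have cover: "A \<subseteq> \<Union>((\<lambda>W. src G ` W) ` \<W>)"
  proof
    fix x assume x: "x \<in> A"
    then have xX: "x \<in> units G" using A by (auto simp: clopen_iff)
    obtain y where y: "y \<in> B" using B by blast
    then have "y \<in> units G" using B(1) by (auto simp: clopen_iff)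
    then have "y \<in> unit_space G closure_of orbit_of G x"
      using minimal xX unfolding minimal_groupoid_def by blast
    moreover have "openin (unit_space G) B" using B(1) by (simp add: \<A>_def clopenin_def)
    ultimately obtain z where "z \<in> orbit_of G x" "z \<in> B"
      using y unfolding in_closure_of by blast
    then obtain g where "g \<in> arrows G" "src G g = x" "rng G g \<in> B"
      unfolding orbit_of_def by blast
    then obtain W where W: "compact_open_G_set G W" "g \<in> W" "src G ` W \<subseteq> A" "rng G ` W \<subseteq> B"
      using compact_open_G_set_at[of g A B] A B x by blast
    then have "W \<in> \<W>" "x \<in> src G ` W" using \<open>src G g = x\<close> by (auto simp: \<W>_def)
    then show "x \<in> \<Union>((\<lambda>W. src G ` W) ` \<W>)" by blast
  qed
  have "compactin \<T> A" using compact_open_G_setD(4)[OF compact_open_G_set_clopen[OF A]] .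
  moreover have "openin \<T> S" if "S \<in> (\<lambda>W. src G ` W) ` \<W>" for S
    using that src_image_clopen by (auto simp: \<W>_def clopen_iff)
  ultimately obtain \<S> where S: "finite \<S>" "\<S> \<subseteq> (\<lambda>W. src G ` W) ` \<W>" "A \<subseteq> \<Union>\<S>"
    using cover unfolding compactin_def by meson
  obtain \<F> where F: "\<F> \<subseteq> \<W>" "finite \<F>" "\<S> = (\<lambda>W. src G ` W) ` \<F>"
    using finite_subset_image[OF S(1,2)] by blast
  obtain U where U: "compact_open_G_set G U" "src G ` U = (\<Union>W\<in>\<F>. src G ` W)" "rng G ` U \<subseteq> B"
    using compare_finite[OF F(2) B(1)] F(1) unfolding \<W>_def by blast
  have "(\<Union>W\<in>\<F>. src G ` W) = A" using S(3) F(1,3) by (auto simp: \<W>_def)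
  then show ?thesis using U by blast
qed

sublocale swapping_group \<Gamma> "units G" \<A>
proof (intro swapping_group.intro swapping_group_axioms.intro)
  show "group \<Gamma>" by (rule group_full_group)
  show "algebra (units G) \<A>" by (rule algebra_clopen)
  then interpret algebra "units G" \<A> .
  show "carrier \<Gamma> \<subseteq> Bij (units G)" by (rule full_group_Bij)
  show "(f \<otimes>\<^bsub>\<Gamma>\<^esub> g) x = f (g x)" if "f \<in> carrier \<Gamma>" "g \<in> carrier \<Gamma>" "x \<in> units G" for f g x
    using that by (rule full_group_mult)
  show "units G \<noteq> {}" using cantor unfolding cantor_space_def topspace_unit_space by blast
  show "f ` A \<in> \<A>" if f: "f \<in> carrier \<Gamma>" and A: "A \<in> \<A>" for f A
  proof -
    obtain U where U: "compact_open_G_set G U" "src G ` U = units G" "rng G ` U = units G"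
        and fU: "\<And>u. u \<in> U \<Longrightarrow> f (src G u) = rng G u"
      using full_groupE[OF f] by blast
    show ?thesis
      using rng_image_clopen[OF compact_open_G_set_restrict_src[OF U(1) A]]
        full_group_image_restrict(2)[OF U(1,2) fU A] by simp
  qed
  show "\<exists>B\<in>\<A>. B \<subset> A \<and> B \<noteq> {}" if A: "A \<in> \<A>" "A \<noteq> {}" for A
  proof -
    obtain x where x: "x \<in> A" using A by blast
    then have xX: "x \<in> units G" using A sets_into_space by blast
    \<comment> \<open>Otherwise \<open>x\<close> would be an isolated point of the Cantor
      set.\<close>
    have "A \<noteq> {x}"
      using cantor xX A(1) unfolding cantor_space_def topspace_unit_space \<A>_def clopenin_def by blast
    then obtain y where y: "y \<in> A" "y \<noteq> x" using x by blast
    have "closedin \<T> {x}" using closedin_Hausdorff_singleton[OF Hausdorff] xX units_subset by blast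
    then have "openin \<T> (A - {x})" using A by (simp add: clopen_iff openin_diff)
    then obtain K where "K \<in> \<A>" "y \<in> K" "K \<subseteq> A - {x}"
      using clopen_between[of "A - {x}" y] y A sets_into_space by blast
    then show ?thesis using x by blast
  qed
  show "\<exists>A\<in>\<A>. x \<in> A \<and> f ` A \<inter> A = {}" if f: "f \<in> carrier \<Gamma>" and x: "x \<in> units G" "f x \<noteq> x" for f x
  proof -
    have "homeomorphic_map (unit_space G) (unit_space G) f"
      using f by (simp add: topological_full_group_def)
    then have c: "continuous_map (unit_space G) (unit_space G) f" by (rule homeomorphic_imp_continuous_map)
    have fx: "f x \<in> units G" using continuous_map_image_subset_topspace[OF c] x(1) unfolding topspace_unit_space by blast
    \<comment> \<open>A clopen neighbourhood of \<open>x\<close> inside \<open>P\<close> and the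
      preimage of \<open>Q\<close> is displaced by \<open>f\<close>.\<close>
    obtain P Q where PQ: "openin (unit_space G) P" "openin (unit_space G) Q" "x \<in> P" "f x \<in> Q" "disjnt P Q"
      using Hausdorff_units x fx unfolding Hausdorff_space_def topspace_unit_space by metis
    have "openin (unit_space G) (P \<inter> {z \<in> units G. f z \<in> Q})"
      using openin_continuous_map_preimage[OF c PQ(2)] PQ(1) unfolding topspace_unit_space
      by (rule openin_Int[rotated])
    then have "openin \<T> (P \<inter> {z \<in> units G. f z \<in> Q})" using units_open by (rule openin_trans_full)
    then obtain K where K: "K \<in> \<A>" "x \<in> K" "K \<subseteq> P \<inter> {z \<in> units G. f z \<in> Q}"
      using clopen_between[of _ x] PQ x by blast
    then have "f ` K \<subseteq> Q" "K \<subseteq> P" by auto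
    then have "f ` K \<inter> K = {}" using PQ(5) unfolding disjnt_def by blast
    then show ?thesis using K by blast
  qed
  show "\<exists>s\<in>carrier \<Gamma>. s ` A \<subseteq> B \<and> (\<forall>x\<in>units G - (A \<union> B). s x = x)"
    if AB: "A \<in> \<A>" "B \<in> \<A>" "B \<noteq> {}" "A \<inter> B = {}" for A B
  proof -
    obtain U where U: "compact_open_G_set G U" "src G ` U = A" "rng G ` U \<subseteq> B"
      using compare[OF AB(1-3)] by blast
    then have "src G ` U \<inter> rng G ` U = {}" using AB by blast
    then obtain s where s: "s \<in> carrier \<Gamma>" "\<forall>u\<in>U. s (src G u) = rng G u"
        "\<forall>x\<in>units G - (src G ` U \<union> rng G ` U). s x = x"
      using full_group_swap[OF U(1)] by blast
    have "s ` src G ` U = rng G ` U"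
      unfolding image_image using s(2) by (intro image_cong refl) simp
    then have "s ` A \<subseteq> B" using U(2,3) by simp
    moreover have "\<forall>x\<in>units G - (A \<union> B). s x = x" using s(3) U(2,3) by blast
    ultimately show ?thesis using s(1) by blast
  qed
  show "\<exists>s\<in>carrier \<Gamma>. (\<forall>x\<in>A. s x = f x) \<and> (\<forall>x\<in>units G - (A \<union> f ` A). s x = x)"
    if f: "f \<in> carrier \<Gamma>" and A: "A \<in> \<A>" and disj: "f ` A \<inter> A = {}" for f A
  proof -
    obtain U where U: "compact_open_G_set G U" "src G ` U = units G" "rng G ` U = units G"
        and fU: "\<And>u. u \<in> U \<Longrightarrow> f (src G u) = rng G u"
      using full_groupE[OF f] by blast
    define U' where "U' = {u \<in> U. src G u \<in> A}"
    have im: "src G ` U' = A" "rng G ` U' = f ` A"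
      unfolding U'_def using full_group_image_restrict[where f = f, OF U(1,2) fU A] by blast+
    have "compact_open_G_set G U'" unfolding U'_def by (rule compact_open_G_set_restrict_src[OF U(1) A])
    moreover have "src G ` U' \<inter> rng G ` U' = {}" using disj im by blast
    ultimately obtain s where s: "s \<in> carrier \<Gamma>" "\<forall>u\<in>U'. s (src G u) = rng G u"
        "\<forall>x\<in>units G - (src G ` U' \<union> rng G ` U'). s x = x"
      using full_group_swap by blast
    have "s x = f x" if "x \<in> A" for x
    proof -
      have "x \<in> src G ` U'" using that im by simp
      then obtain u where "u \<in> U'" "x = src G u" by blast
      then show ?thesis using s(2) fU by (simp add: U'_def)
    qed
    then show ?thesis using s(1,3) unfolding im by blast
  qed
qed

end

theorem theorem4p16:
  fixes G :: "'g groupoid"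
  assumes "etale_groupoid G"
    and "essentially_principal G"
    and "cantor_space (unit_space G)"
    and "purely_infinite G"
    and "minimal_groupoid G"
  shows "(\<forall>H. subgroup H (topological_full_group G) \<and>
              H \<noteq> {\<one>\<^bsub>topological_full_group G\<^esub>} \<and>
              normalized_by (topological_full_group G) H
                (commutator_subgroup (topological_full_group G))
            \<longrightarrow> commutator_subgroup (topological_full_group G) \<subseteq> H) \<and>
         simple_as_group ((topological_full_group G)
           \<lparr>carrier := commutator_subgroup (topological_full_group G)\<rparr>)"
proof -
  interpret etale_groupoid G by (rule assms(1))
  \<comment> \<open>Essential principality presents the unit space as an interior, hence as an open
    set.\<close>
  have "openin (arrow_topology G) (units G)"
    using assms(2) unfolding essentially_principal_def by (metis openin_interior_of)
  then interpret purely_infinite_minimal_groupoid G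
    by unfold_locales (use assms in auto)
  show ?thesis using derived_subset derived_simple by blast
qed

end
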